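(* Let $C(z)=\frac{1-\sqrt{1-4z}}{2z}=\sum_{n\ge 0}\operatorname{Cat}(n)z^n$ be the generating function of the Catalan numbers, and for $\xi\ge 0$ let $W_\xi(z)=\sum_{\ell\ge 0}\frac{w_{\ell-\xi+1,2\ell}}{(\ell-\xi+1)!}z^\ell$ be the generating function of tree walks of excess $\xi$. Then $W_0(z)=C(z)$, and for every $\xi\ge 1$ there are polynomials $(K_{\xi,s}(x))_{0\le s\le 2\xi-2}$ with non-negative coefficients, $K_{\xi,s}$ of degree $2\xi+s$, such that \[ W_\xi(z)=C(z)\sum_{s=0}^{2\xi-2}\frac{K_{\xi,s}\big(zC(z)^2\big)}{\big(1-zC(z)^2\big)^{s+1}}. \] Moreover $K_{\xi,2\xi-2}(x)=\operatorname{Cat}(\xi-1)x^{4\xi-2}$ for all $\xi\ge 1$, and $K_{\xi,2\xi-3}(x)=(3\xi-1)\operatorname{Cat}(\xi-1)x^{4\xi-3}$ for all $\xi\ge 2$.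
   Context: A tree walk of size $m$ and length $L$ is a sequence $W=(v_1,\dots,v_L)$ of elements of $[m]=\{1,\dots,m\}$ in which every element of $[m]$ occurs, such that the graph $T(W)$ with vertex set $[m]$ and edge set $\{\{v_j,v_{j+1}\}:1\le j<L\}\cup\{\{v_L,v_1\}\}$ is a tree; $W$ is regarded as the closed walk $v_1\to v_2\to\dots\to v_L\to v_1$ and $v_1$ is the root of $T(W)$. By convention the one-vertex walk of length $0$ is a tree walk of size $1$. Every tree walk has even length. $w_{m,2\ell}$ denotes the number of tree walks of size $m$ and length $2\ell$, with $w_{1,0}=1$, $w_{0,0}=0$, $w_{0,2\ell}=w_{1,2\ell}=0$ for $\ell\ge 1$, and $w_{m,2\ell}=0$ whenever $m<0$. Each edge of $T(W)$ is traversed $2k$ times ($k\ge1$) by the closed walk; its excess is $k-1$. The excess of $W$ is the sum of the excesses of the edges of $T(W)$, equal to $\ell-(m-1)$ for a walk of length $2\ell$ and size $m$. $\operatorname{Cat}(n)=\frac{1}{n+1}\binom{2n}{n}$. *)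

theory Defs
  imports "HOL-Computational_Algebra.Polynomial" "HOL-Computational_Algebra.Formal_Power_Series"
begin

text \<open>Edge set of the closed walk v_1 -> ... -> v_L -> v_1 given as a list.\<close>
definition walk_edges :: "nat list \<Rightarrow> nat set set" where
  "walk_edges W = {{W ! j, W ! (j + 1)} | j. j + 1 < length W}
                  \<union> (if W = [] then {} else {{last W, hd W}})"

text \<open>A (simple, loopless) graph on vertex set V with edge set E is a tree if every
  edge is a 2-element subset of V, the graph is connected, and it has card V - 1 edges.\<close>
definition is_tree :: "nat set \<Rightarrow> nat set set \<Rightarrow> bool" where
  "is_tree V E \<longleftrightarrow> finite V \<and> V \<noteq> {} \<and>
     (\<forall>e\<in>E. e \<subseteq> V \<and> card e = 2) \<and>
     (\<forall>u\<in>V. \<forall>v\<in>V. (u, v) \<in> {(a, b). {a, b} \<in> E}\<^sup>*) \<and>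
     card E = card V - 1"

text \<open>Tree walks of size m (with the convention that the empty walk is a tree walk of size 1).\<close>
definition tree_walk :: "nat \<Rightarrow> nat list \<Rightarrow> bool" where
  "tree_walk m W \<longleftrightarrow> (m = 1 \<and> W = []) \<or>
     (W \<noteq> [] \<and> set W = {1..m} \<and> is_tree {1..m} (walk_edges W))"

text \<open>w m L: number of tree walks of size m and length L.\<close>
definition w :: "nat \<Rightarrow> nat \<Rightarrow> nat" where
  "w m L = card {W. tree_walk m W \<and> length W = L}"

definition Cat :: "nat \<Rightarrow> real" where
  "Cat n = real (2 * n choose n) / real (n + 1)"

text \<open>Catalan generating function C(z).\<close>
definition C_fps :: "real fps" where
  "C_fps = Abs_fps Cat"

text \<open>W_xi(z) = sum over l of w_{l-xi+1,2l}/(l-xi+1)! z^l, with w_{m,.} = 0 for m < 0.\<close>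
definition W_fps :: "nat \<Rightarrow> real fps" where
  "W_fps \<xi> = Abs_fps (\<lambda>l. if l + 1 < \<xi> then 0
                           else real (w (l + 1 - \<xi>) (2 * l)) / fact (l + 1 - \<xi>))"

text \<open>Evaluation of a real polynomial at a formal power series.\<close>
definition poly_at_fps :: "real poly \<Rightarrow> real fps \<Rightarrow> real fps" where
  "poly_at_fps p f = poly (map_poly fps_const p) f"

end

theory Submission
  imports Defs "HOL-Computational_Algebra.Formal_Laurent_Series"
begin

text \<open>Delete the first edge \<open>{v, c}\<close> of a tree walk with root \<open>v\<close>: the walk alternates between blocks of a
  tree walk on the component of \<open>v\<close> and blocks of a tree walk on the component of \<open>c\<close>. Let \<open>b k\<close> be the series
  (in \<open>t\<close>, which marks the excess, over power series in \<open>z\<close>) of tree walks cut into \<open>k\<close> blocks that are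
  empty or start at the root. Then
  \<open>b (k + 1) = b k + (\<Sum>p. binom (k + p, k) z^(p + 1) t^p b (k + p + 1) b (p + 1))\<close> and \<open>b 0 = 1\<close>, so that the
  coefficient of \<open>t^0\<close> in \<open>b 1\<close> is \<open>C\<close>.

  Put \<open>x = z C^2\<close>, \<open>Y = (1 - x) / x\<close>, and divide the coefficient of \<open>t^\<xi>\<close> by \<open>(x / Y)^(2 \<xi>)\<close>. After
  normalising by powers of \<open>C\<close> and of \<open>1 - x (b 1 / C - 1)\<close>, all coefficients become
  non-negative combinations of \<open>Y^j (1 + Y)^i\<close> with \<open>i, j \<le> 2 \<xi>\<close>; for \<open>b 1 / C - 1\<close>, up to the factor \<open>Y^2 / (1 - x)\<close>, the bound is \<open>2 \<xi> - 2\<close>. The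
  powers \<open>Y^j\<close> give the kernels \<open>x^(2 \<xi> + s) / (1 - x)^(s + 1)\<close> with \<open>s = 2 \<xi> - 2 - j\<close>, the remaining terms only
  contribute lower powers of \<open>x\<close> to \<open>s = 0\<close>, and the two top kernels come from
  the value and the derivative of these combinations at \<open>Y = 0\<close>.\<close>

section \<open>Edges of closed walks\<close>

text \<open>The unknowns are chosen so that no minus sign survives. The summand \<open>p = 0\<close>
  of the recursion contains \<open>b (k + 1) b 1\<close>; moving it to the left produces the factor
  \<open>1 - z b 1\<close>, and this is \<open>1 - x (b 1 / C - 1)\<close> divided by
  \<open>C\<close>, the origin of the normalisation. The scale \<open>(x / Y)^2\<close> for the
  excess is the one that turns the remaining weights into \<open>Y^(2 p + 2) (1 + Y)^p\<close>. As
  \<open>1 + Y = 1 / x\<close>, its powers lower the power of \<open>x\<close>; the bound on their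
  exponent keeps the kernels polynomial. The binomial coefficient arises because the cuts of the
  whole walk and the cuts made by the first edge fall on the same root component: together they are
  \<open>k + p\<close> cuts, of which \<open>k\<close> are chosen. Exact degrees require every
  \<open>Y^j\<close> to occur with positive weight, which is tracked along with value and slope.
  Since \<open>Y\<close> has a pole at \<open>z = 0\<close>, the algebra takes place in Laurent
  series. The factor \<open>3 \<xi> - 1\<close> is the value at \<open>n = \<xi> - 1\<close> of the
  factor \<open>3 n + 2\<close> in the solution of the linearised Catalan equation.\<close>

fun path_edges :: "'a list \<Rightarrow> 'a set set" where
  "path_edges (x # y # xs) = insert {x, y} (path_edges (y # xs))"
| "path_edges _ = {}"

lemma path_edges_append:
  "path_edges (xs @ x # ys) = path_edges (xs @ [x]) \<union> path_edges (x # ys)"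
proof (induction xs)
  case (Cons a xs)
  then show ?case by (cases xs) auto
qed simp

lemma path_edges_Cons: "ys \<noteq> [] \<Longrightarrow> path_edges (x # ys) = insert {x, hd ys} (path_edges ys)"
  by (cases ys) auto

lemma path_edges_subset: "e \<in> path_edges xs \<Longrightarrow> e \<subseteq> set xs"
  by (induction xs rule: path_edges.induct) auto

lemma finite_path_edges [simp]: "finite (path_edges xs)"
  by (induction xs rule: path_edges.induct) auto

text \<open>A vertex that does not occur later brings a new edge. When a tree walk is split, this
  bound for both parts forces equality in both.\<close>

lemma card_set_le_path_edges: "xs \<noteq> [] \<Longrightarrow> card (set xs) \<le> card (path_edges xs) + 1"
proof (induction xs rule: path_edges.induct)
  case (1 x y xs)
  show ?case
  proof (cases "x \<in> set (y # xs)")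
    case True
    then have "set (x # y # xs) = set (y # xs)" by auto
    moreover have "card (path_edges (y # xs)) \<le> card (path_edges (x # y # xs))"
      by (intro card_mono) auto
    ultimately show ?thesis using 1 by simp
  next
    case False
    then have "{x, y} \<notin> path_edges (y # xs)" using path_edges_subset by fastforce
    then have "card (path_edges (x # y # xs)) = Suc (card (path_edges (y # xs)))" by simp
    moreover have "card (set (x # y # xs)) = Suc (card (set (y # xs)))" using False by simp
    ultimately show ?thesis using 1 by simp
  qed
qed auto

section \<open>Reachability and the number of edges\<close>

definition adj :: "'a set set \<Rightarrow> ('a \<times> 'a) set" where
  "adj E = {(a, b). {a, b} \<in> E}"

lemma adj_mono: "E \<subseteq> F \<Longrightarrow> adj E \<subseteq> adj F"
  by (auto simp: adj_def)

lemma adj_rtrancl_sym: "(u, v) \<in> (adj E)\<^sup>* \<Longrightarrow> (v, u) \<in> (adj E)\<^sup>*"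
  by (rule symD[OF sym_rtrancl]) (auto simp: adj_def sym_def insert_commute)

lemma path_edges_connected: "u \<in> set xs \<Longrightarrow> (hd xs, u) \<in> (adj (path_edges xs))\<^sup>*"
proof (induction xs rule: path_edges.induct)
  case (1 x y xs)
  show ?case
  proof (cases "u = x")
    case False
    then have "(y, u) \<in> (adj (path_edges (y # xs)))\<^sup>*" using 1 by simp
    moreover have "(adj (path_edges (y # xs)))\<^sup>* \<subseteq> (adj (path_edges (x # y # xs)))\<^sup>*"
      by (intro rtrancl_mono adj_mono) auto
    moreover have "(x, y) \<in> adj (path_edges (x # y # xs))" by (simp add: adj_def)
    ultimately show ?thesis by (auto intro: converse_rtrancl_into_rtrancl)
  qed simp
qed auto

text \<open>Breadth-first search: every reachable \<open>u\<close> other than \<open>v\<close> has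
  an edge to some \<open>p u\<close> closer to \<open>v\<close>. Two vertices with the same edge
  would be parents of each other, which the distances exclude, so this assignment is
  injective.\<close>

lemma finite_card_reachable:
  assumes "finite E"
  shows "finite {u. (v, u) \<in> (adj E)\<^sup>*}" "card {u. (v, u) \<in> (adj E)\<^sup>*} \<le> card E + 1"
proof -
  define R where "R = {u. (v, u) \<in> (adj E)\<^sup>*}"
  define d where "d = (\<lambda>u. LEAST n. (v, u) \<in> adj E ^^ n)"
  have dI: "(v, u) \<in> adj E ^^ d u" if "u \<in> R" for u
  proof -
    have "\<exists>n. (v, u) \<in> adj E ^^ n" using that by (simp add: R_def rtrancl_power)
    then show ?thesis unfolding d_def by (rule LeastI_ex)
  qed
  have d_le: "d u \<le> n" if "(v, u) \<in> adj E ^^ n" for u n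
    unfolding d_def using that by (rule Least_le)
  have "\<exists>p. {p, u} \<in> E \<and> d p < d u" if u: "u \<in> R - {v}" for u
  proof (cases "d u")
    case 0
    then show ?thesis using dI[of u] u by simp
  next
    case (Suc m)
    then obtain p where "(v, p) \<in> adj E ^^ m" "(p, u) \<in> adj E"
      using dI[of u] u by auto
    then show ?thesis using d_le[of p m] Suc by (auto simp: adj_def intro!: exI[of _ p])
  qed
  then obtain p where p: "\<And>u. u \<in> R - {v} \<Longrightarrow> {p u, u} \<in> E \<and> d (p u) < d u" by metis
  have inj: "inj_on (\<lambda>u. {p u, u}) (R - {v})"
  proof (rule inj_onI)
    fix x y assume x: "x \<in> R - {v}" and y: "y \<in> R - {v}" and eq: "{p x, x} = {p y, y}"
    show "x = y"
    proof (rule ccontr)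
      assume "x \<noteq> y"
      then have "p x = y" "p y = x" using eq by (auto simp: doubleton_eq_iff)
      then show False using p[OF x] p[OF y] by simp
    qed
  qed
  have im: "(\<lambda>u. {p u, u}) ` (R - {v}) \<subseteq> E" using p by auto
  have fin: "finite (R - {v})" using finite_imageD[OF finite_subset[OF im assms] inj] .
  then show "finite {u. (v, u) \<in> (adj E)\<^sup>*}" by (simp add: R_def)
  have "card (R - {v}) \<le> card E" using card_inj_on_le[OF inj im assms] .
  then show "card {u. (v, u) \<in> (adj E)\<^sup>*} \<le> card E + 1"
    unfolding R_def[symmetric] using card_Diff_singleton_if[of R v] by (auto split: if_splits)
qed

text \<open>The root is a separate argument so that the empty walk has one too. A closed walk
  connects its vertices, so of the tree conditions only two-element edges and the edge count
  remain.\<close>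

definition root_walk :: "'a \<Rightarrow> 'a list \<Rightarrow> bool" where
  "root_walk v W \<longleftrightarrow> hd (W @ [v]) = v \<and> (\<forall>e\<in>path_edges (W @ [v]). card e = 2) \<and>
     card (path_edges (W @ [v])) + 1 = card (insert v (set W))"

lemma path_edges_nth: "path_edges xs = {{xs ! j, xs ! (j + 1)} | j. j + 1 < length xs}"
proof (induction xs rule: path_edges.induct)
  case (1 x y xs)
  have "{{(x # y # xs) ! j, (x # y # xs) ! (j + 1)} | j. j + 1 < length (x # y # xs)}
      = insert {x, y} {{(y # xs) ! j, (y # xs) ! (j + 1)} | j. j + 1 < length (y # xs)}" (is "?L = ?R")
  proof
    show "?L \<subseteq> ?R"
    proof
      fix e assume "e \<in> ?L"
      then obtain j where "e = {(x # y # xs) ! j, (x # y # xs) ! (j + 1)}" "j + 1 < length (x # y # xs)"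
        by blast
      then show "e \<in> ?R" by (cases j) auto
    qed
    show "?R \<subseteq> ?L"
    proof
      fix e assume "e \<in> ?R"
      then consider "e = {x, y}" | j where "e = {(y # xs) ! j, (y # xs) ! (j + 1)}" "j + 1 < length (y # xs)"
        by blast
      then show "e \<in> ?L"
      proof cases
        case 1 then show ?thesis by (intro CollectI exI[of _ 0]) simp
      next
        case (2 j) then show ?thesis by (intro CollectI exI[of _ "Suc j"]) simp
      qed
    qed
  qed
  then show ?case using 1 by simp
qed auto

lemma walk_edges_eq: 
  assumes "W \<noteq> []"
  shows "walk_edges W = path_edges (W @ [hd W])"
proof -
  have W: "W = butlast W @ [last W]" using assms by simp
  have "path_edges (W @ [hd W]) = path_edges (butlast W @ last W # [hd W])"
    by (subst W) simp
  also have "\<dots> = path_edges W \<union> {{last W, hd W}}"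
    by (subst path_edges_append) (use assms in simp)
  finally show ?thesis using assms by (simp add: walk_edges_def path_edges_nth)
qed

lemma tree_walk_iff:
  "tree_walk m W \<longleftrightarrow> (\<exists>v. root_walk v W \<and> insert v (set W) = {1..m})"
proof (cases "W = []")
  case True
  have "(\<exists>v. {v} = {1..m}) \<longleftrightarrow> m = 1"
    by (metis atLeastAtMost_singleton atLeastAtMost_singleton_iff)
  then show ?thesis using True by (simp add: tree_walk_def root_walk_def)
next
  case False
  let ?E = "path_edges (W @ [hd W])"
  have conn: "(u, v) \<in> {(a, b). {a, b} \<in> ?E}\<^sup>*" if "u \<in> set W" "v \<in> set W" for u v
  proof -
    have "(hd W, x) \<in> (adj ?E)\<^sup>*" if "x \<in> set W" for x
      using path_edges_connected[of x "W @ [hd W]"] that False by simp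
    then have "(u, v) \<in> (adj ?E)\<^sup>*"
      using that by (meson adj_rtrancl_sym rtrancl_trans)
    then show ?thesis by (simp add: adj_def)
  qed
  have sub: "e \<subseteq> set W" if "e \<in> ?E" for e using path_edges_subset[OF that] False by auto
  have ins: "insert (hd W) (set W) = set W" using False by auto
  have pos: "card (set W) > 0" using False by (simp add: card_gt_0_iff)
  have hd: "root_walk v W \<Longrightarrow> v = hd W" for v using False by (simp add: root_walk_def)
  have main: "root_walk (hd W) W \<longleftrightarrow> is_tree (set W) (walk_edges W)"
    using False conn sub ins pos unfolding root_walk_def is_tree_def walk_edges_eq[OF False]
    by auto
  show ?thesis
    using False main hd ins unfolding tree_walk_def by metis
qed

text \<open>The closed walk that crosses the edge \<open>{v, c}\<close> back and forth \<open>length As\<close> times, following a block of \<open>Bs\<close>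
  before each return from \<open>c\<close> and a block of \<open>As\<close> after it. As in the definition of a tree walk, the list omits
  the final return to \<open>v\<close>.\<close>
fun weave :: "'a \<Rightarrow> 'a \<Rightarrow> 'a list list \<Rightarrow> 'a list list \<Rightarrow> 'a list" where
  "weave v c (a # As) (b # Bs) = v # b @ c # a @ weave v c As Bs"
| "weave v c _ _ = []"

definition blocks :: "'a \<Rightarrow> 'a list list \<Rightarrow> bool" where
  "blocks v As \<longleftrightarrow> (\<forall>a\<in>set As. hd (a @ [v]) = v)"

lemma blocks_simps [simp]:
  "blocks v []" "blocks v (a # As) \<longleftrightarrow> hd (a @ [v]) = v \<and> blocks v As"
  by (auto simp: blocks_def)

lemma hd_concat_blocks: "blocks v As \<Longrightarrow> hd (concat As @ [v]) = v"
  by (induction As) (auto simp: hd_append split: if_splits)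

lemma ex_Cons_snoc: "hd (xs @ [v]) = v \<Longrightarrow> \<exists>ys. xs @ [v] = v # ys"
  by (cases xs) auto

lemma hd_weave: "hd (weave v c As Bs @ [v]) = v"
  by (cases "(v, c, As, Bs)" rule: weave.cases) auto

lemma path_edges_concat_blocks:
  "blocks v As \<Longrightarrow> path_edges (concat As @ [v]) = (\<Union>a\<in>set As. path_edges (a @ [v]))"
proof (induction As)
  case (Cons a As)
  then obtain ys where ys: "concat As @ [v] = v # ys"
    using ex_Cons_snoc[OF hd_concat_blocks] by (metis blocks_simps(2))
  have "path_edges (concat (a # As) @ [v]) = path_edges (a @ v # ys)" using ys by simp
  also have "\<dots> = path_edges (a @ [v]) \<union> path_edges (concat As @ [v])"
    by (subst path_edges_append) (simp add: ys)
  finally show ?case using Cons by simp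
qed simp

lemma set_weave:
  "length As = length Bs \<Longrightarrow>
    insert v (set (weave v c As Bs)) =
      insert v (set (concat As)) \<union> (if As = [] then {} else insert c (set (concat Bs)))"
proof (induction As Bs rule: list_induct2)
  case (Cons a As b Bs)
  have "insert v (set (weave v c (a # As) (b # Bs))) =
      insert c (set b \<union> set a \<union> insert v (set (weave v c As Bs)))" by auto
  then show ?case unfolding Cons.IH by (cases "As = []") (use Cons.hyps in auto)
qed simp

lemma length_weave:
  "length As = length Bs \<Longrightarrow>
    length (weave v c As Bs) = 2 * length As + length (concat As) + length (concat Bs)"
  by (induction As Bs rule: list_induct2) auto

lemma count_weave:
  "length As = length Bs \<Longrightarrow> v \<noteq> c \<Longrightarrow> v \<notin> set (concat Bs) \<Longrightarrow>
    count_list (weave v c As Bs) v = length As + count_list (concat As) v"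
  by (induction As Bs rule: list_induct2) auto

lemma path_edges_weave:
  "length As = length Bs \<Longrightarrow> blocks v As \<Longrightarrow> blocks c Bs \<Longrightarrow>
    path_edges (weave v c As Bs @ [v]) =
      (if As = [] then {} else {{v, c}}) \<union> path_edges (concat As @ [v]) \<union> path_edges (concat Bs @ [c])"
proof (induction As Bs rule: list_induct2)
  case (Cons a As b Bs)
  let ?R = "weave v c As Bs @ [v]"
  obtain R where R: "?R = v # R" using ex_Cons_snoc[OF hd_weave] by metis
  have a: "hd (a @ v # R) = v" and b: "hd (b @ c # a @ v # R) = c"
    using Cons.prems by (simp_all add: hd_append split: if_splits)
  have "path_edges (weave v c (a # As) (b # Bs) @ [v]) = path_edges (v # b @ c # a @ v # R)"
    using R by simp
  also have "\<dots> = insert {v, c} (path_edges (b @ c # a @ v # R))"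
    using b by (subst path_edges_Cons) auto
  also have "path_edges (b @ c # a @ v # R) = path_edges (b @ [c]) \<union> path_edges (c # a @ v # R)"
    by (rule path_edges_append)
  also have "path_edges (c # a @ v # R) = insert {c, v} (path_edges (a @ v # R))"
    using a by (subst path_edges_Cons) auto
  also have "path_edges (a @ v # R) = path_edges (a @ [v]) \<union> path_edges ?R"
    by (subst path_edges_append) (simp add: R)
  finally have "path_edges (weave v c (a # As) (b # Bs) @ [v]) =
     {{v, c}} \<union> path_edges (b @ [c]) \<union> path_edges (a @ [v]) \<union> path_edges ?R"
    by (auto simp: insert_commute)
  moreover have "path_edges (concat (a # As) @ [v]) = path_edges (a @ [v]) \<union> path_edges (concat As @ [v])"
    using Cons.prems by (simp add: path_edges_concat_blocks[of v "a # As", simplified] path_edges_concat_blocks)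
  moreover have "path_edges (concat (b # Bs) @ [c]) = path_edges (b @ [c]) \<union> path_edges (concat Bs @ [c])"
    using Cons.prems by (simp add: path_edges_concat_blocks[of c "b # Bs", simplified] path_edges_concat_blocks)
  moreover have "path_edges ?R = (if As = [] then {} else {{v, c}}) \<union> path_edges (concat As @ [v]) \<union> path_edges (concat Bs @ [c])"
    using Cons by simp
  ultimately show ?case by auto
qed simp

section \<open>Splitting a tree walk at its first edge\<close>

text \<open>\<open>P\<close> will be the side of \<open>v\<close> once the edge is deleted, so the
  walk changes sides only along \<open>{v, c}\<close>. For the induction on \<open>W\<close> the
  walk may start anywhere: on the side of \<open>P\<close> it begins with a piece \<open>a\<close>
  of an unfinished block, off \<open>P\<close> with such a piece \<open>b\<close>.\<close>

lemma weave_decomposition: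
  assumes "v \<in> P" "c \<notin> P"
    and "\<And>x y. {x, y} \<in> path_edges (W @ [v]) \<Longrightarrow> x \<in> P \<Longrightarrow> y \<notin> P \<Longrightarrow> x = v \<and> y = c"
  shows "(hd (W @ [v]) \<in> P \<longrightarrow> (\<exists>a As Bs. W = a @ weave v c As Bs \<and> length As = length Bs \<and>
            blocks v As \<and> blocks c Bs \<and> set a \<union> set (concat As) \<subseteq> P \<and> set (concat Bs) \<inter> P = {})) \<and>
         (hd (W @ [v]) \<notin> P \<longrightarrow> (\<exists>b a As Bs. W = b @ c # a @ weave v c As Bs \<and> length As = length Bs \<and>
            blocks v (a # As) \<and> blocks c Bs \<and> set a \<union> set (concat As) \<subseteq> P \<and>
            (set b \<union> set (concat Bs)) \<inter> P = {}))"
  using assms(3)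
proof (induction W)
  case Nil
  show ?case using \<open>v \<in> P\<close> by (auto intro!: exI[of _ "[]"])
next
  case (Cons x W)
  let ?y = "hd (W @ [v])"
  have pe: "path_edges ((x # W) @ [v]) = insert {x, ?y} (path_edges (W @ [v]))"
    by (simp add: path_edges_Cons)
  have cross: "x \<in> P \<Longrightarrow> ?y \<notin> P \<Longrightarrow> x = v \<and> ?y = c" "?y \<in> P \<Longrightarrow> x \<notin> P \<Longrightarrow> ?y = v \<and> x = c"
    using Cons.prems[of x ?y] Cons.prems[of ?y x] unfolding pe by (auto simp: insert_commute)
  have IH: "(?y \<in> P \<longrightarrow> (\<exists>a As Bs. W = a @ weave v c As Bs \<and> length As = length Bs \<and>
            blocks v As \<and> blocks c Bs \<and> set a \<union> set (concat As) \<subseteq> P \<and> set (concat Bs) \<inter> P = {})) \<and>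
         (?y \<notin> P \<longrightarrow> (\<exists>b a As Bs. W = b @ c # a @ weave v c As Bs \<and> length As = length Bs \<and>
            blocks v (a # As) \<and> blocks c Bs \<and> set a \<union> set (concat As) \<subseteq> P \<and>
            (set b \<union> set (concat Bs)) \<inter> P = {}))"
  proof (rule Cons.IH)
    fix x' y' assume "{x', y'} \<in> path_edges (W @ [v])" "x' \<in> P" "y' \<notin> P"
    then show "x' = v \<and> y' = c" by (intro Cons.prems) (unfold pe, rule insertI2)
  qed
  show ?case
  proof (cases "x \<in> P"; cases "?y \<in> P")
    assume x: "x \<in> P" and y: "?y \<in> P"
    obtain a As Bs where *: "W = a @ weave v c As Bs" "length As = length Bs"
      "blocks v As" "blocks c Bs" "set a \<union> set (concat As) \<subseteq> P" "set (concat Bs) \<inter> P = {}"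
      using IH y by blast
    then have "x # W = (x # a) @ weave v c As Bs" "set (x # a) \<union> set (concat As) \<subseteq> P"
      using x by simp_all
    then have "\<exists>a As Bs. x # W = a @ weave v c As Bs \<and> length As = length Bs \<and>
            blocks v As \<and> blocks c Bs \<and> set a \<union> set (concat As) \<subseteq> P \<and> set (concat Bs) \<inter> P = {}"
      using * by blast
    then show ?thesis using x by simp
  next
    assume x: "x \<in> P" and y: "?y \<notin> P"
    obtain b a As Bs where *: "W = b @ c # a @ weave v c As Bs" "length As = length Bs"
      "blocks v (a # As)" "blocks c Bs" "set a \<union> set (concat As) \<subseteq> P" "(set b \<union> set (concat Bs)) \<inter> P = {}"
      using IH y by blast
    \<comment> \<open>The crossing from \<open>v\<close> to \<open>c\<close> completes the open
      piece \<open>b\<close>, and \<open>a\<close> with \<open>b\<close> becomes the first pair of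
      blocks.\<close>
    have "x = v" "?y = c" using cross x y by auto
    then have "hd (b @ [c]) = c" using *(1) by (cases b) auto
    then have "x # W = [] @ weave v c (a # As) (b # Bs)" "length (a # As) = length (b # Bs)"
       "blocks v (a # As)" "blocks c (b # Bs)" "set [] \<union> set (concat (a # As)) \<subseteq> P" "set (concat (b # Bs)) \<inter> P = {}"
      using * \<open>x = v\<close> by auto
    then have "\<exists>a As Bs. x # W = a @ weave v c As Bs \<and> length As = length Bs \<and>
            blocks v As \<and> blocks c Bs \<and> set a \<union> set (concat As) \<subseteq> P \<and> set (concat Bs) \<inter> P = {}"
      by blast
    then show ?thesis using x by simp
  next
    assume x: "x \<notin> P" and y: "?y \<in> P"
    obtain a As Bs where *: "W = a @ weave v c As Bs" "length As = length Bs"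
      "blocks v As" "blocks c Bs" "set a \<union> set (concat As) \<subseteq> P" "set (concat Bs) \<inter> P = {}"
      using IH y by blast
    have "x = c" "?y = v" using cross x y by auto
    then have "hd (a @ [v]) = v" using *(1) by (cases a) auto
    then have "x # W = [] @ c # a @ weave v c As Bs" "blocks v (a # As)"
       "(set [] \<union> set (concat Bs)) \<inter> P = {}"
      using * \<open>x = c\<close> by auto
    then have "\<exists>b a As Bs. x # W = b @ c # a @ weave v c As Bs \<and> length As = length Bs \<and>
            blocks v (a # As) \<and> blocks c Bs \<and> set a \<union> set (concat As) \<subseteq> P \<and>
            (set b \<union> set (concat Bs)) \<inter> P = {}"
      using * by blast
    then show ?thesis using x by simp
  next
    assume x: "x \<notin> P" and y: "?y \<notin> P"
    obtain b a As Bs where *: "W = b @ c # a @ weave v c As Bs" "length As = length Bs"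
      "blocks v (a # As)" "blocks c Bs" "set a \<union> set (concat As) \<subseteq> P" "(set b \<union> set (concat Bs)) \<inter> P = {}"
      using IH y by blast
    then have "x # W = (x # b) @ c # a @ weave v c As Bs" "(set (x # b) \<union> set (concat Bs)) \<inter> P = {}"
      using x by auto
    then have "\<exists>b a As Bs. x # W = b @ c # a @ weave v c As Bs \<and> length As = length Bs \<and>
            blocks v (a # As) \<and> blocks c Bs \<and> set a \<union> set (concat As) \<subseteq> P \<and>
            (set b \<union> set (concat Bs)) \<inter> P = {}"
      using * by blast
    then show ?thesis using x by simp
  qed
qed

lemma takeWhile_append_stop:
  "(\<forall>x\<in>set xs. Q x) \<Longrightarrow> (ys = [] \<or> \<not> Q (hd ys)) \<Longrightarrow> takeWhile Q (xs @ ys) = xs"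
  by (induction xs) (auto simp: takeWhile_eq_Nil_iff)

text \<open>Once \<open>P\<close> is known, the blocks can be read off: after the leading
  \<open>v\<close>, the maximal run outside \<open>P\<close> is \<open>b @ [c]\<close>, and the next
  run inside \<open>P\<close> is \<open>a\<close>, followed by the \<open>v\<close> of the next
  crossing if there is one.\<close>

lemma weave_unique:
  assumes "length As = length Bs" "length As' = length Bs'" "v \<in> P" "c \<notin> P"
    "set (concat As) \<subseteq> P" "set (concat As') \<subseteq> P" "set (concat Bs) \<inter> P = {}" "set (concat Bs') \<inter> P = {}"
    "weave v c As Bs = weave v c As' Bs'"
  shows "As = As' \<and> Bs = Bs'"
  using assms
proof (induction As Bs arbitrary: As' Bs' rule: list_induct2)
  case Nil
  then show ?case by (cases As'; cases Bs') auto
next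
  case (Cons a As b Bs)
  obtain a' As2 b' Bs2 where eq: "As' = a' # As2" "Bs' = b' # Bs2" "length As2 = length Bs2"
    using Cons.prems by (cases As'; cases Bs') auto
  let ?R = "weave v c As Bs" and ?R' = "weave v c As2 Bs2"
  have hdR: "?R = [] \<or> hd ?R \<in> P" "?R' = [] \<or> hd ?R' \<in> P"
    using hd_weave[of v c As Bs] hd_weave[of v c As2 Bs2] \<open>v \<in> P\<close>
    by (cases ?R; cases ?R'; simp)+
  have all: "b @ c # a @ ?R = b' @ c # a' @ ?R'" using Cons.prems eq by simp
  have aP: "set a \<subseteq> P" "set a' \<subseteq> P" "set b \<inter> P = {}" "set b' \<inter> P = {}"
    using Cons.prems eq by auto
  have 1: "takeWhile (\<lambda>x. x \<notin> P) ((b @ [c]) @ (a @ ?R)) = b @ [c]"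
    using aP hdR \<open>c \<notin> P\<close> by (intro takeWhile_append_stop) (auto simp: hd_append split: if_splits)
  have 2: "takeWhile (\<lambda>x. x \<notin> P) ((b' @ [c]) @ (a' @ ?R')) = b' @ [c]"
    using aP hdR \<open>c \<notin> P\<close> by (intro takeWhile_append_stop) (auto simp: hd_append split: if_splits)
  have bb: "b = b'" using 1 2 all by simp
  then have R: "a @ ?R = a' @ ?R'" using all by simp
  have tl: "takeWhile (\<lambda>x. x \<in> P) (xs @ weave v c Xs Ys) = (if Xs = [] then xs else xs @ [v])"
    if A: "set xs \<subseteq> P" "length Xs = length Ys" "set (concat Ys) \<inter> P = {}" for xs Xs Ys
  proof (cases Xs)
    case Nil
    then show ?thesis using that by (auto simp: takeWhile_eq_all_conv)
  next
    case (Cons x Xs1)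
    then obtain y Ys1 where Y: "Ys = y # Ys1" using A(2) by (cases Ys) auto
    have "takeWhile (\<lambda>x. x \<in> P) ((xs @ [v]) @ (y @ c # x @ weave v c Xs1 Ys1)) = xs @ [v]"
      using A \<open>v \<in> P\<close> \<open>c \<notin> P\<close> Y
      by (intro takeWhile_append_stop; cases y) auto
    then show ?thesis using Cons Y by simp
  qed
  have d: "set (concat Bs) \<inter> P = {}" "set (concat Bs2) \<inter> P = {}"
    using Cons.prems eq by auto
  have ta: "(if As = [] then a else a @ [v]) = (if As2 = [] then a' else a' @ [v])"
    using tl[OF aP(1) Cons.hyps(1) d(1)] tl[OF aP(2) eq(3) d(2)] by (simp only: R)
  \<comment> \<open>Only a block that is not the last is followed by \<open>v\<close>, so
    \<open>ta\<close> identifies the blocks only if both weaves stop or both go on. Whether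
    \<open>c\<close> occurs again decides this.\<close>
  have sR: "As = [] \<longleftrightarrow> As2 = []"
  proof -
    have "c \<in> set (a @ ?R) \<longleftrightarrow> As \<noteq> []" using aP Cons.hyps \<open>c \<notin> P\<close> by (cases As; cases Bs) auto
    moreover have "c \<in> set (a' @ ?R') \<longleftrightarrow> As2 \<noteq> []" using aP eq \<open>c \<notin> P\<close> by (cases As2; cases Bs2) auto
    ultimately show ?thesis using R by simp
  qed
  then have "a = a'" using ta by (simp split: if_splits)
  moreover from this R have "?R = ?R'" by simp
  then have "As = As2 \<and> Bs = Bs2"
    using Cons.prems eq by (intro Cons.IH) auto
  ultimately show ?case using bb eq by simp
qed

definition woven :: "'a \<Rightarrow> 'a \<times> 'a list list \<times> 'a list list \<Rightarrow> bool" where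
  "woven v = (\<lambda>(c, As, Bs). As \<noteq> [] \<and> length As = length Bs \<and> blocks v As \<and> blocks c Bs \<and>
     root_walk v (concat As) \<and> root_walk c (concat Bs) \<and>
     insert v (set (concat As)) \<inter> insert c (set (concat Bs)) = {})"

lemma woven_root_walk:
  assumes "woven v (c, As, Bs)"
  shows "root_walk v (weave v c As Bs)"
proof -
  let ?E1 = "path_edges (concat As @ [v])" and ?E2 = "path_edges (concat Bs @ [c])"
  let ?S1 = "insert v (set (concat As))" and ?S2 = "insert c (set (concat Bs))"
  note w = assms[unfolded woven_def split_conv]
  have ne: "As \<noteq> []" and len: "length As = length Bs" using w by auto
  have E: "path_edges (weave v c As Bs @ [v]) = insert {v, c} (?E1 \<union> ?E2)"
    using w by (subst path_edges_weave) auto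
  have S: "insert v (set (weave v c As Bs)) = ?S1 \<union> ?S2"
    using set_weave[OF len] ne by auto
  have disj: "?S1 \<inter> ?S2 = {}" using w by auto
  have e1: "e \<subseteq> ?S1" "card e = 2" if "e \<in> ?E1" for e
    using path_edges_subset[OF that] w that by (auto simp: root_walk_def)
  have e2: "e \<subseteq> ?S2" "card e = 2" if "e \<in> ?E2" for e
    using path_edges_subset[OF that] w that by (auto simp: root_walk_def)
  have "?E1 \<inter> ?E2 = {}"
  proof (rule ccontr)
    assume "?E1 \<inter> ?E2 \<noteq> {}"
    then obtain e where "e \<in> ?E1" "e \<in> ?E2" by auto
    then have "e \<subseteq> {}" "card e = 2" using e1[of e] e2[of e] disj by blast+
    then show False by simp
  qed
  moreover have "{v, c} \<notin> ?E1" "{v, c} \<notin> ?E2" using e1(1)[of "{v, c}"] e2(1)[of "{v, c}"] disj by blast+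
  ultimately have "card (path_edges (weave v c As Bs @ [v])) = Suc (card ?E1 + card ?E2)"
    unfolding E by (simp add: card_Un_disjoint)
  moreover have "card (?S1 \<union> ?S2) = card ?S1 + card ?S2"
    using disj by (intro card_Un_disjoint) auto
  moreover have "card ?E1 + 1 = card ?S1" "card ?E2 + 1 = card ?S2" using w by (simp_all add: root_walk_def)
  moreover have "v \<noteq> c" using disj by auto
  ultimately show ?thesis
    unfolding root_walk_def S using hd_weave[of v c As Bs] e1(2) e2(2) unfolding E by auto
qed

text \<open>\<open>c\<close> is the second vertex of the closed walk and \<open>P\<close> the
  component of \<open>v\<close> after deletion of \<open>{v, c}\<close>;
  \<open>weave_decomposition\<close> then supplies the blocks, and edge counting shows that both
  parts are trees.\<close>

lemma root_walk_woven:
  assumes "root_walk v W" "W \<noteq> []"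
  shows "\<exists>c As Bs. woven v (c, As, Bs) \<and> W = weave v c As Bs"
proof -
  obtain W' where W': "W = v # W'" using assms by (cases W) (auto simp: root_walk_def)
  define c where "c = hd (W' @ [v])"
  define E where "E = path_edges (W @ [v])"
  define E' where "E' = E - {{v, c}}"
  define P where "P = {u. (v, u) \<in> (adj E')\<^sup>*}"
  let ?S = "insert v (set W)"
  have c2: "card e = 2" if "e \<in> E" for e using assms that by (auto simp: root_walk_def E_def)
  have cE: "card E + 1 = card ?S" using assms by (simp add: root_walk_def E_def)
  have E_eq: "E = insert {v, c} (path_edges (W' @ [v]))"
    unfolding E_def W' c_def by (simp add: path_edges_Cons)
  have vc: "v \<noteq> c" using c2[of "{v, c}"] E_eq by auto
  have finE: "finite E'" "finite E" by (simp_all add: E'_def E_def)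
  have cardE': "card E = card E' + 1" unfolding E'_def using card.remove[OF finE(2), of "{v, c}"] E_eq by (metis Suc_eq_plus1 insertI1)
  have vP: "v \<in> P" by (simp add: P_def)
  \<comment> \<open>In a tree every edge is a bridge: if \<open>c\<close> were still reachable, all
    vertices would be, with one edge fewer than \<open>finite_card_reachable\<close> allows.\<close>
  have cP: "c \<notin> P"
  proof
    assume "c \<in> P"
    then have vc': "(v, c) \<in> (adj E')\<^sup>*" "(c, v) \<in> (adj E')\<^sup>*" by (auto simp: P_def intro: adj_rtrancl_sym)
    have "adj E \<subseteq> (adj E')\<^sup>*"
    proof
      fix p assume "p \<in> adj E"
      then have "p \<in> adj E' \<or> p = (v, c) \<or> p = (c, v)"
        by (cases p) (auto simp: adj_def E'_def doubleton_eq_iff)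
      then show "p \<in> (adj E')\<^sup>*" using vc' by auto
    qed
    then have "(adj E)\<^sup>* \<subseteq> (adj E')\<^sup>*" by (rule rtrancl_subset_rtrancl)
    moreover have "(v, u) \<in> (adj E)\<^sup>*" if "u \<in> ?S" for u
      using path_edges_connected[of u "W @ [v]"] that W' by (simp add: E_def)
    ultimately have "?S \<subseteq> P" by (auto simp: P_def)
    then have "card ?S \<le> card E' + 1"
      using finite_card_reachable[OF finE(1), of v] card_mono[of P ?S] by (simp add: P_def)
    then show False using cE cardE' by simp
  qed
  have cross: "x = v \<and> y = c" if "{x, y} \<in> E" "x \<in> P" "y \<notin> P" for x y
  proof (rule ccontr)
    assume ne: "\<not> (x = v \<and> y = c)"
    have "{x, y} \<noteq> {v, c}" using ne that vP cP by (auto simp: doubleton_eq_iff)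
    then have "(x, y) \<in> adj E'" using that by (auto simp: adj_def E'_def)
    then show False using that by (auto simp: P_def intro: rtrancl_into_rtrancl)
  qed
  have "\<exists>b a As Bs. W' = b @ c # a @ weave v c As Bs \<and> length As = length Bs \<and>
            blocks v (a # As) \<and> blocks c Bs \<and> set a \<union> set (concat As) \<subseteq> P \<and>
            (set b \<union> set (concat Bs)) \<inter> P = {}"
    using weave_decomposition[of v P c W'] vP cP cross unfolding c_def[symmetric] E_eq by blast
  then obtain b a As0 Bs0 where dec: "W' = b @ c # a @ weave v c As0 Bs0" "length As0 = length Bs0"
    "blocks v (a # As0)" "blocks c Bs0" "set a \<union> set (concat As0) \<subseteq> P" "(set b \<union> set (concat Bs0)) \<inter> P = {}"
    by blast
  define As where "As = a # As0"
  define Bs where "Bs = b # Bs0"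
  have "hd (W' @ [v]) = hd (b @ [c])" by (subst dec(1)) (cases b; simp)
  then have hb: "hd (b @ [c]) = c" by (simp add: c_def)
  have W: "W = weave v c As Bs" using W' dec by (simp add: As_def Bs_def)
  have bl: "blocks v As" "blocks c Bs" "As \<noteq> []" "length As = length Bs"
    using dec hb by (auto simp: As_def Bs_def)
  let ?S1 = "insert v (set (concat As))" and ?S2 = "insert c (set (concat Bs))"
  let ?E1 = "path_edges (concat As @ [v])" and ?E2 = "path_edges (concat Bs @ [c])"
  have sub: "?S1 \<subseteq> P" "?S2 \<inter> P = {}" using dec vP cP by (auto simp: As_def Bs_def)
  then have disj: "?S1 \<inter> ?S2 = {}" by blast
  have S: "?S = ?S1 \<union> ?S2" using set_weave[OF bl(4), of v c] bl(3) unfolding W by auto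
  have E: "E = insert {v, c} (?E1 \<union> ?E2)"
    unfolding E_def W using bl by (subst path_edges_weave) auto
  have "card E \<le> Suc (card ?E1 + card ?E2)"
    unfolding E using card_insert_le_m1 card_Un_le[of ?E1 ?E2] by (simp add: card_insert_if)
  moreover have "card ?S = card ?S1 + card ?S2" unfolding S using disj by (intro card_Un_disjoint) auto
  moreover have "{v, c} \<notin> ?E1" "{v, c} \<notin> ?E2" "?E1 \<inter> ?E2 = {}"
  proof -
    show "{v, c} \<notin> ?E1" "{v, c} \<notin> ?E2"
      using path_edges_subset[of "{v, c}" "concat As @ [v]"] path_edges_subset[of "{v, c}" "concat Bs @ [c]"] disj
      by auto
    show "?E1 \<inter> ?E2 = {}"
    proof (rule ccontr)
      assume "?E1 \<inter> ?E2 \<noteq> {}"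
      then obtain e where "e \<in> ?E1" "e \<in> ?E2" by auto
      then have "e \<subseteq> ?S1" "e \<subseteq> ?S2" "card e = 2"
        using path_edges_subset[of e "concat As @ [v]"] path_edges_subset[of e "concat Bs @ [c]"] c2[of e] E
        by auto
      then have "e \<subseteq> {}" "card e = 2" using disj by blast+
      then show False by simp
    qed
  qed
  then have "card E = Suc (card ?E1 + card ?E2)" unfolding E by (simp add: card_Un_disjoint)
  \<comment> \<open>The sum of these two inequalities is an equality by the edge count of the whole
    tree, so each is one.\<close>
  moreover have "card ?S1 \<le> card ?E1 + 1" "card ?S2 \<le> card ?E2 + 1"
    using card_set_le_path_edges[of "concat As @ [v]"] card_set_le_path_edges[of "concat Bs @ [c]"] by simp_all
  ultimately have "card ?S1 = card ?E1 + 1" "card ?S2 = card ?E2 + 1" using cE by linarith+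
  moreover have "\<forall>e\<in>?E1. card e = 2" "\<forall>e\<in>?E2. card e = 2" using c2 E by auto
  ultimately have "root_walk v (concat As)" "root_walk c (concat Bs)"
    using hd_concat_blocks bl by (simp_all add: root_walk_def)
  then have "woven v (c, As, Bs)" using bl disj by (simp add: woven_def)
  then show ?thesis using W by blast
qed

text \<open>The vertex set of the root side is thus determined by the walk and \<open>c\<close>
  alone, which makes \<open>weave_unique\<close> applicable to two decompositions of one
  walk.\<close>

lemma woven_side:
  assumes "woven v (c, As, Bs)"
  shows "{u. (v, u) \<in> (adj (path_edges (weave v c As Bs @ [v]) - {{v, c}}))\<^sup>*} = insert v (set (concat As))"
proof -
  note w = assms[unfolded woven_def split_conv]
  let ?E1 = "path_edges (concat As @ [v])" and ?E2 = "path_edges (concat Bs @ [c])"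
  let ?S1 = "insert v (set (concat As))" and ?S2 = "insert c (set (concat Bs))"
  let ?E' = "path_edges (weave v c As Bs @ [v]) - {{v, c}}"
  have disj: "?S1 \<inter> ?S2 = {}" using w by auto
  have "?E' = (?E1 \<union> ?E2) - {{v, c}}"
    using w by (subst path_edges_weave) auto
  also have "\<dots> = ?E1 \<union> ?E2"
    using path_edges_subset[of "{v, c}" "concat As @ [v]"] path_edges_subset[of "{v, c}" "concat Bs @ [c]"] disj
    by auto
  finally have E': "?E' = ?E1 \<union> ?E2" .
  have step: "y \<in> ?S1" if "x \<in> ?S1" "(x, y) \<in> adj ?E'" for x y
  proof -
    have "{x, y} \<in> ?E1 \<or> {x, y} \<in> ?E2" using that unfolding E' adj_def by auto
    then have "{x, y} \<subseteq> ?S1 \<or> {x, y} \<subseteq> ?S2"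
      using path_edges_subset[of "{x, y}" "concat As @ [v]"] path_edges_subset[of "{x, y}" "concat Bs @ [c]"] by auto
    then show ?thesis using that disj by blast
  qed
  have "u \<in> ?S1" if "(v, u) \<in> (adj ?E')\<^sup>*" for u
    using that by (induction rule: rtrancl_induct) (use step in auto)
  moreover have "(v, u) \<in> (adj ?E')\<^sup>*" if "u \<in> ?S1" for u
  proof -
    have "(hd (concat As @ [v]), u) \<in> (adj ?E1)\<^sup>*" using that by (intro path_edges_connected) auto
    moreover have "hd (concat As @ [v]) = v" using w by (intro hd_concat_blocks) auto
    moreover have "(adj ?E1)\<^sup>* \<subseteq> (adj ?E')\<^sup>*" unfolding E' by (intro rtrancl_mono adj_mono) auto
    ultimately show ?thesis by auto
  qed
  ultimately show ?thesis by blast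
qed

lemma woven_inj:
  assumes "woven v (c, As, Bs)" "woven v (c', As', Bs')" "weave v c As Bs = weave v c' As' Bs'"
  shows "c = c' \<and> As = As' \<and> Bs = Bs'"
proof -
  \<comment> \<open>The first block on the far side is empty or starts at \<open>d\<close>, so in
    both cases \<open>d\<close> is the second entry.\<close>
  have snd: "hd (tl (weave v d Xs Ys)) = d" if "woven v (d, Xs, Ys)" for d Xs Ys
    using that by (cases Xs; cases Ys) (auto simp: woven_def hd_append split: if_splits)
  have c: "c = c'" using snd[OF assms(1)] snd[OF assms(2)] assms(3) by simp
  have S: "insert v (set (concat As)) = insert v (set (concat As'))"
    using woven_side[OF assms(1)] woven_side[OF assms(2)] assms(3) c by simp
  have "As = As' \<and> Bs = Bs'"
  proof (rule weave_unique)
    show "weave v c As Bs = weave v c As' Bs'" using assms c by simp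
    show "set (concat As) \<subseteq> insert v (set (concat As))" "v \<in> insert v (set (concat As))" by auto
    show "set (concat As') \<subseteq> insert v (set (concat As))" unfolding S by auto
    show "set (concat Bs') \<inter> insert v (set (concat As)) = {}" unfolding S using assms(2) by (auto simp: woven_def)
    show "set (concat Bs) \<inter> insert v (set (concat As)) = {}" using assms(1) by (auto simp: woven_def)
    show "c \<notin> insert v (set (concat As))" "length As = length Bs" using assms(1) by (auto simp: woven_def)
    show "length As' = length Bs'" using assms(2) by (auto simp: woven_def)
  qed
  then show ?thesis using c by simp
qed

lemma bij_betw_weave:
  "bij_betw (\<lambda>(c, As, Bs). weave v c As Bs) (Collect (woven v)) {W. root_walk v W \<and> W \<noteq> []}"
proof (rule bij_betw_imageI)
  show "inj_on (\<lambda>(c, As, Bs). weave v c As Bs) (Collect (woven v))"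
  proof (rule inj_onI)
    fix p q
    assume "p \<in> Collect (woven v)" "q \<in> Collect (woven v)"
      "(case p of (c, As, Bs) \<Rightarrow> weave v c As Bs) = (case q of (c, As, Bs) \<Rightarrow> weave v c As Bs)"
    then show "p = q" using woven_inj[of v] by (cases p; cases q) simp
  qed
  have "weave v c As Bs \<noteq> []" if "woven v (c, As, Bs)" for c As Bs
    using that by (cases As; cases Bs) (auto simp: woven_def)
  then show "(\<lambda>(c, As, Bs). weave v c As Bs) ` Collect (woven v) = {W. root_walk v W \<and> W \<noteq> []}"
  proof (intro set_eqI iffI)
    fix W assume "W \<in> {W. root_walk v W \<and> W \<noteq> []}"
    then obtain c As Bs where "woven v (c, As, Bs)" "W = weave v c As Bs"
      using root_walk_woven[of v W] by blast
    then show "W \<in> (\<lambda>(c, As, Bs). weave v c As Bs) ` Collect (woven v)"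
      by (intro image_eqI[of _ _ "(c, As, Bs)"]) simp_all
  qed (use woven_root_walk in auto)
qed

section \<open>Counting tree walks\<close>

definition block_lists :: "'a \<Rightarrow> nat \<Rightarrow> 'a list \<Rightarrow> 'a list list set" where
  "block_lists v k W = {As. length As = k \<and> concat As = W \<and> blocks v As}"

text \<open>Number of ways to cut a walk with \<open>r\<close> visits to the root into
  \<open>k\<close> blocks. Without any block only the empty walk is left, hence the special
  case.\<close>

definition splittings :: "nat \<Rightarrow> nat \<Rightarrow> nat" where
  "splittings k r = (case k of 0 \<Rightarrow> if r = 0 then 1 else 0 | Suc k \<Rightarrow> (r + k) choose k)"

text \<open>Cuttings into \<open>k + 1\<close> blocks in which the first one may start anywhere.
  This removes the condition on the head of \<open>W\<close>, so that the count can go by induction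
  on \<open>W\<close>.\<close>

definition first_free :: "'a \<Rightarrow> nat \<Rightarrow> 'a list \<Rightarrow> ('a list \<times> 'a list list) set" where
  "first_free v k W = {(a, As). length As = k \<and> a @ concat As = W \<and> blocks v As}"

lemma block_lists_Suc:
  assumes "hd (W @ [v]) = v"
  shows "block_lists v (Suc k) W = (\<lambda>(a, As). a # As) ` first_free v k W"
proof (intro set_eqI iffI)
  fix As assume "As \<in> block_lists v (Suc k) W"
  then show "As \<in> (\<lambda>(a, As). a # As) ` first_free v k W"
    by (cases As) (auto simp: block_lists_def first_free_def intro!: image_eqI[of _ _ "(hd As, tl As)"])
next
  fix As assume "As \<in> (\<lambda>(a, As). a # As) ` first_free v k W"
  then obtain a Bs where *: "As = a # Bs" "(a, Bs) \<in> first_free v k W" by auto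
  then have "hd (a @ [v]) = v" using assms by (cases a) (auto simp: first_free_def)
  then show "As \<in> block_lists v (Suc k) W" using * by (auto simp: block_lists_def first_free_def)
qed

lemma first_free_Cons:
  "first_free v k (x # W) =
     (\<lambda>(a, As). (x # a, As)) ` first_free v k W \<union> (\<lambda>As. ([], As)) ` block_lists v k (x # W)"
proof (intro set_eqI iffI)
  fix p assume p: "p \<in> first_free v k (x # W)"
  obtain a As where "p = (a, As)" by (cases p)
  then show "p \<in> (\<lambda>(a, As). (x # a, As)) ` first_free v k W \<union> (\<lambda>As. ([], As)) ` block_lists v k (x # W)"
    using p by (cases a) (auto simp: block_lists_def first_free_def intro!: image_eqI[of _ _ "(tl a, As)"])
qed (auto simp: block_lists_def first_free_def)

text \<open>Stars and bars: \<open>k\<close> cuts, with repetition, are placed before occurrences of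
  \<open>v\<close> or at the end. At an entry \<open>v\<close> the first block may be empty, and the
  cuttings of this kind are those with one block fewer of the same list; hence the inner induction
  on \<open>k\<close>, which is Pascal's rule.\<close>

lemma card_first_free:
  "finite (first_free v k W) \<and> card (first_free v k W) = (count_list W v + k) choose k"
proof (induction W arbitrary: k)
  case Nil
  have "first_free v k [] = {([], replicate k [])}"
    by (auto simp: first_free_def intro: replicate_eqI simp: blocks_def)
  then show ?case by simp
next
  case (Cons x W)
  have split: "finite (first_free v k (x # W)) \<and>
      card (first_free v k (x # W)) = ((count_list W v + k) choose k) + card (block_lists v k (x # W))"
    if A: "finite (block_lists v k (x # W))" for k
  proof -
    have "card ((\<lambda>(a, As). (x # a, As)) ` first_free v k W) = card (first_free v k W)"
      "card ((\<lambda>As. ([] :: 'a list, As)) ` block_lists v k (x # W)) = card (block_lists v k (x # W))"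
      by (intro card_image; auto simp: inj_on_def)+
    then show ?thesis unfolding first_free_Cons using A Cons.IH[of k]
      by (subst card_Un_disjoint) auto
  qed
  show ?case
  proof (cases "x = v")
    case False
    have "\<not> blocks v As" if "concat As = x # W" for As
      using hd_concat_blocks[of v As] False that by auto
    then have "block_lists v k (x # W) = {}" by (auto simp: block_lists_def)
    then show ?thesis using split[of k] False by simp
  next
    case True
    show ?thesis
    proof (induction k)
      case 0
      have "block_lists v 0 (x # W) = {}" by (auto simp: block_lists_def)
      then show ?case using split[of 0] by simp
    next
      case (Suc k)
      have eq: "block_lists v (Suc k) (x # W) = (\<lambda>(a, As). a # As) ` first_free v k (x # W)"
        using True by (intro block_lists_Suc) simp
      have "inj_on (\<lambda>(a, As). a # As) (first_free v k (x # W))" by (auto simp: inj_on_def)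
      then have "finite (block_lists v (Suc k) (x # W))"
        "card (block_lists v (Suc k) (x # W)) = (count_list (x # W) v + k) choose k"
        using eq Suc by (simp_all add: card_image)
      then show ?case using split[of "Suc k"] True by simp
    qed
  qed
qed

lemma card_block_lists:
  assumes "hd (W @ [v]) = v"
  shows "finite (block_lists v k W)" "card (block_lists v k W) = splittings k (count_list W v)"
proof -
  have "finite (block_lists v k W) \<and> card (block_lists v k W) = splittings k (count_list W v)"
  proof (cases k)
    case 0
    have "block_lists v 0 W = (if W = [] then {[]} else {})" by (auto simp: block_lists_def)
    moreover have "count_list W v = 0 \<longleftrightarrow> W = []" using assms by (cases W) auto
    ultimately show ?thesis using 0 by (simp add: splittings_def)
  next
    case (Suc j)
    have "inj_on (\<lambda>(a, As). a # As) (first_free v j W)" by (auto simp: inj_on_def)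
    then show ?thesis
      using card_first_free[of v j W] by (simp add: Suc block_lists_Suc[OF assms] card_image splittings_def)
  qed
  then show "finite (block_lists v k W)" "card (block_lists v k W) = splittings k (count_list W v)" by auto
qed

section \<open>Weighted sums over the walks on a given vertex set\<close>

definition root_walks :: "'a set \<Rightarrow> 'a \<Rightarrow> nat \<Rightarrow> 'a list set" where
  "root_walks S v L = {W. root_walk v W \<and> insert v (set W) = S \<and> length W = L}"

lemma finite_root_walks: "finite S \<Longrightarrow> finite (root_walks S v L)"
  by (rule finite_subset[OF _ finite_lists_length_eq[of S L]]) (auto simp: root_walks_def)

definition walk_sum :: "nat \<Rightarrow> 'a set \<Rightarrow> 'a \<Rightarrow> nat \<Rightarrow> real" where
  "walk_sum k S v L = (\<Sum>W\<in>root_walks S v L. real (splittings k (count_list W v)))"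

definition steps :: "nat \<Rightarrow> (nat \<times> nat) set" where
  "steps L = {(K, L1). 1 \<le> K \<and> 2 * K + L1 \<le> L}"

lemma finite_steps [simp]: "finite (steps L)"
  by (rule finite_subset[of _ "{..L} \<times> {..L}"]) (auto simp: steps_def)

text \<open>The walks are grouped by the far component \<open>S2\<close>, its vertex
  \<open>c\<close>, the number \<open>K\<close> of blocks on either side, and the two concatenated
  walks. Forgetting the block boundaries leaves fibres that are products of two
  \<open>block_lists\<close>. The weave visits \<open>v\<close> exactly \<open>K\<close> times more
  often than its root side does.\<close>

lemma sum_root_walks:
  fixes g :: "nat \<Rightarrow> real"
  assumes S: "finite S" "v \<in> S"
  shows "(\<Sum>W\<in>root_walks S v L. g (count_list W v)) =
    (if S = {v} \<and> L = 0 then g 0 else 0) +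
    (\<Sum>(S2, c)\<in>(SIGMA S2:Pow (S - {v}). S2). \<Sum>(K, L1)\<in>steps L.
       (\<Sum>W\<in>root_walks (S - S2) v L1. real (splittings K (count_list W v)) * g (K + count_list W v)) *
       walk_sum K S2 c (L - 2 * K - L1))"
proof -
  let ?w = "\<lambda>(c, As, Bs). weave v c As Bs"
  define N where "N = {W \<in> root_walks S v L. W \<noteq> []}"
  define X where "X = {x \<in> Collect (woven v). ?w x \<in> N}"
  define P where "P = (SIGMA S2:Pow (S - {v}). S2)"
  define T where "T = (SIGMA p:P. SIGMA q:steps L.
     root_walks (S - fst p) v (snd q) \<times> root_walks (fst p) (snd p) (L - 2 * fst q - snd q))"
  define h where "h = (\<lambda>(c, As, Bs). ((insert c (set (concat Bs)), c), (length As, length (concat As)),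
      (concat As, concat Bs)) :: ('a set \<times> 'a) \<times> (nat \<times> nat) \<times> ('a list \<times> 'a list))"
  have finP: "finite P" unfolding P_def using S by (intro finite_SigmaI) (auto intro: finite_subset)
  have finsub: "finite (fst p)" if "p \<in> P" for p
  proof (rule finite_subset[OF _ S(1)])
    show "fst p \<subseteq> S" using that by (auto simp: P_def)
  qed
  have finT: "finite T" unfolding T_def using finP finsub S
    by (intro finite_SigmaI finite_cartesian_product finite_root_walks) auto
  have bij: "bij_betw ?w X N"
  proof -
    have "bij_betw ?w {x \<in> Collect (woven v). ?w x \<in> N} {y \<in> {W. root_walk v W \<and> W \<noteq> []}. y \<in> N}"
      using bij_betw_weave[of v] by (intro bij_betw_Collect) auto
    moreover have "{y \<in> {W. root_walk v W \<and> W \<noteq> []}. y \<in> N} = N" by (auto simp: N_def root_walks_def)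
    ultimately show ?thesis by (simp add: X_def)
  qed
  have finN: "finite N" using finite_root_walks[OF S(1)] by (simp add: N_def)
  have finX: "finite X" using bij_betw_finite[OF bij] finN by simp
  have X_iff: "(c, As, Bs) \<in> X \<longleftrightarrow> woven v (c, As, Bs) \<and>
     insert v (set (concat As)) \<union> insert c (set (concat Bs)) = S \<and>
     2 * length As + length (concat As) + length (concat Bs) = L" for c As Bs
  proof (cases "woven v (c, As, Bs)")
    case True
    then have "length As = length Bs" "As \<noteq> []" by (auto simp: woven_def)
    then show ?thesis
      using True woven_root_walk[OF True] set_weave[of As Bs v c] length_weave[of As Bs v c]
      by (auto simp: X_def N_def root_walks_def)
  qed (simp add: X_def)
  have hX: "h ` X \<subseteq> T"
  proof
    fix y assume "y \<in> h ` X"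
    then obtain c As Bs where x: "(c, As, Bs) \<in> X" and y: "y = h (c, As, Bs)" by auto
    note x' = x[unfolded X_iff woven_def split_conv]
    let ?S1 = "insert v (set (concat As))" and ?S2 = "insert c (set (concat Bs))"
    have "?S1 \<inter> ?S2 = {}" "?S1 \<union> ?S2 = S" using x' by auto
    then have "S - ?S2 = ?S1" "?S2 \<subseteq> S - {v}" by blast+
    then show "y \<in> T" using x' unfolding y
      by (auto simp: h_def T_def P_def steps_def root_walks_def Suc_le_eq)
  qed
  have fibre: "{x \<in> X. h x = ((S2, c), (K, L1), (W1, W2))} = {c} \<times> block_lists v K W1 \<times> block_lists c K W2"
    if A: "((S2, c), (K, L1), (W1, W2)) \<in> T" for S2 c K L1 W1 W2
  proof (intro set_eqI iffI)
    fix x assume "x \<in> {x \<in> X. h x = ((S2, c), (K, L1), (W1, W2))}"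
    then show "x \<in> {c} \<times> block_lists v K W1 \<times> block_lists c K W2"
      by (cases x) (auto simp: h_def X_iff block_lists_def woven_def)
  next
    fix x assume "x \<in> {c} \<times> block_lists v K W1 \<times> block_lists c K W2"
    then obtain As Bs where x: "x = (c, As, Bs)" "As \<in> block_lists v K W1" "Bs \<in> block_lists c K W2" by auto
    have As: "length As = K" "concat As = W1" "blocks v As" "length Bs = K" "concat Bs = W2" "blocks c Bs"
      using x by (simp_all add: block_lists_def)
    have T: "S2 \<subseteq> S - {v}" "c \<in> S2" "1 \<le> K" "2 * K + L1 \<le> L"
      "root_walk v W1" "insert v (set W1) = S - S2" "length W1 = L1"
      "root_walk c W2" "insert c (set W2) = S2" "length W2 = L - 2 * K - L1"
      using A by (simp_all add: T_def P_def steps_def root_walks_def)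
    have "As \<noteq> []" using As(1) T(3) by auto
    moreover have "insert v (set (concat As)) \<inter> insert c (set (concat Bs)) = {}"
      unfolding As T by blast
    ultimately have "woven v (c, As, Bs)"
      unfolding woven_def split_conv As(2,5) using As(1,3,4,6) T(5,8) by simp
    moreover have "insert v (set (concat As)) \<union> insert c (set (concat Bs)) = S"
      unfolding As T using T(1) by blast
    moreover have "2 * length As + length (concat As) + length (concat Bs) = L"
      unfolding As T using T(4) by simp
    ultimately have "(c, As, Bs) \<in> X" unfolding X_iff by blast
    moreover have "h (c, As, Bs) = ((S2, c), (K, L1), (W1, W2))"
      unfolding h_def split_conv As T by simp
    ultimately show "x \<in> {x \<in> X. h x = ((S2, c), (K, L1), (W1, W2))}"
      unfolding x by blast
  qed
  have fib_sum: "(\<Sum>x\<in>{x \<in> X. h x = y}. g (count_list (?w x) v)) =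
     (case y of ((S2, c), (K, L1), (W1, W2)) \<Rightarrow>
      real (splittings K (count_list W1 v)) * g (K + count_list W1 v) * real (splittings K (count_list W2 c)))"
    if A: "y \<in> T" for y
  proof -
    obtain S2 c K L1 W1 W2 where y: "y = ((S2, c), (K, L1), (W1, W2))" by (metis prod.collapse)
    have W: "hd (W1 @ [v]) = v" "hd (W2 @ [c]) = c" using A y by (auto simp: T_def root_walks_def root_walk_def)
    have "g (count_list (?w x) v) = g (K + count_list W1 v)" if B: "x \<in> {x \<in> X. h x = y}" for x
    proof -
      obtain d As Bs where x: "x = (d, As, Bs)" by (cases x)
      then have "length As = length Bs" "v \<noteq> d" "v \<notin> set (concat Bs)" "K = length As" "W1 = concat As"
        using B y by (auto simp: X_iff woven_def h_def)
      then show ?thesis using count_weave[of As Bs v d] x by simp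
    qed
    then have "(\<Sum>x\<in>{x \<in> X. h x = y}. g (count_list (?w x) v)) = real (card {x \<in> X. h x = y}) * g (K + count_list W1 v)"
      by simp
    also have "card {x \<in> X. h x = y} = splittings K (count_list W1 v) * splittings K (count_list W2 c)"
      unfolding y using A unfolding y
      by (subst fibre) (auto simp: card_cartesian_product card_block_lists W)
    finally show ?thesis by (simp add: y)
  qed
  have "(\<Sum>W\<in>N. g (count_list W v)) = (\<Sum>x\<in>X. g (count_list (?w x) v))"
    by (rule sum.reindex_bij_betw[OF bij, symmetric])
  also have "\<dots> = (\<Sum>y\<in>T. \<Sum>x\<in>{x \<in> X. h x = y}. g (count_list (?w x) v))"
    by (rule sum.group[OF finX finT hX, symmetric])
  also have "\<dots> = (\<Sum>y\<in>T. case y of ((S2, c), (K, L1), (W1, W2)) \<Rightarrow>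
      real (splittings K (count_list W1 v)) * g (K + count_list W1 v) * real (splittings K (count_list W2 c)))"
    by (rule sum.cong[OF refl]) (rule fib_sum)
  also have "\<dots> = (\<Sum>p\<in>P. \<Sum>q\<in>steps L. \<Sum>W1\<in>root_walks (S - fst p) v (snd q).
      \<Sum>W2\<in>root_walks (fst p) (snd p) (L - 2 * fst q - snd q).
      real (splittings (fst q) (count_list W1 v)) * g (fst q + count_list W1 v) *
      real (splittings (fst q) (count_list W2 (snd p))))"
  proof -
    define f where "f p q r = real (splittings (fst q) (count_list (fst r) v)) * g (fst q + count_list (fst r) v) *
      real (splittings (fst q) (count_list (snd r) (snd p)))" for p :: "'a set \<times> 'a" and q :: "nat \<times> nat" and r
    define R where "R p q = root_walks (S - fst p) v (snd q) \<times> root_walks (fst p) (snd p) (L - 2 * fst q - snd q)"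
      for p :: "'a set \<times> 'a" and q :: "nat \<times> nat"
    have finR: "finite (R p q)" if "p \<in> P" for p q
      unfolding R_def using finsub[OF that] S by (intro finite_cartesian_product finite_root_walks) auto
    have "(\<Sum>y\<in>T. case y of ((S2, c), (K, L1), (W1, W2)) \<Rightarrow>
      real (splittings K (count_list W1 v)) * g (K + count_list W1 v) * real (splittings K (count_list W2 c))) =
      (\<Sum>(p, y)\<in>(SIGMA p:P. SIGMA q:steps L. R p q). f p (fst y) (snd y))"
      by (simp add: case_prod_unfold f_def T_def R_def)
    also have "\<dots> = (\<Sum>p\<in>P. \<Sum>y\<in>(SIGMA q:steps L. R p q). f p (fst y) (snd y))"
      using finP finR by (intro sum.Sigma[symmetric]) auto
    also have "\<dots> = (\<Sum>p\<in>P. \<Sum>q\<in>steps L. \<Sum>r\<in>R p q. f p q r)"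
      using finR by (intro sum.cong refl) (subst sum.Sigma, auto simp: case_prod_unfold)
    also have "\<dots> = (\<Sum>p\<in>P. \<Sum>q\<in>steps L. \<Sum>W1\<in>root_walks (S - fst p) v (snd q).
      \<Sum>W2\<in>root_walks (fst p) (snd p) (L - 2 * fst q - snd q). f p q (W1, W2))"
      unfolding R_def by (simp add: sum.cartesian_product case_prod_unfold)
    finally show ?thesis by (simp add: f_def)
  qed
  also have "\<dots> = (\<Sum>(S2, c)\<in>P. \<Sum>(K, L1)\<in>steps L.
       (\<Sum>W\<in>root_walks (S - S2) v L1. real (splittings K (count_list W v)) * g (K + count_list W v)) *
       walk_sum K S2 c (L - 2 * K - L1))"
    by (simp add: case_prod_unfold walk_sum_def sum_product)
  finally have main: "(\<Sum>W\<in>N. g (count_list W v)) = \<dots>" .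
  have "root_walks S v L = N \<union> (if S = {v} \<and> L = 0 then {[]} else {})"
    by (auto simp: N_def root_walks_def root_walk_def)
  moreover have "[] \<notin> N" by (simp add: N_def)
  ultimately have "(\<Sum>W\<in>root_walks S v L. g (count_list W v)) =
     (\<Sum>W\<in>N. g (count_list W v)) + (if S = {v} \<and> L = 0 then g 0 else 0)"
    using finN by simp
  then show ?thesis using main by (simp add: P_def)
qed

text \<open>This closes the recursion: the cuts made by the first edge and the cuts of the whole
  walk merge into one cutting of the root side into \<open>k + K\<close> blocks. The identity is the
  trinomial revision \<open>choose_mult\<close>.\<close>

lemma splittings_mult_diff:
  assumes "K \<ge> 1"
  shows "real (splittings K r) * (real (splittings (Suc k) (K + r)) - real (splittings k (K + r))) =
    real ((k + K - 1) choose k) * real (splittings (k + K) r)"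
proof -
  obtain j where K: "K = Suc j" using assms by (cases K) auto
  have "splittings (Suc k) (K + r) = splittings k (K + r) + ((j + r + k) choose k)"
    by (cases k) (simp_all add: splittings_def K add_ac)
  moreover have "(j + r + k choose (j + k)) * (j + k choose k) = (j + r + k choose k) * (r + j choose j)"
    using choose_mult[of k "j + k" "j + r + k"] by (simp add: add_ac)
  then have "real (r + j choose j) * real (j + r + k choose k) = real (j + k choose k) * real (r + (j + k) choose (j + k))"
    unfolding of_nat_mult[symmetric] by (simp add: mult_ac add_ac)
  ultimately show ?thesis by (simp add: splittings_def K add_ac)
qed

lemma walk_sum_0:
  assumes "v \<in> S"
  shows "walk_sum 0 S v L = (if S = {v} \<and> L = 0 then 1 else 0)"
proof -
  have "real (splittings 0 (count_list W v)) = (if W = [] then 1 else 0)" if "W \<in> root_walks S v L" for W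
    using that by (cases W) (auto simp: root_walks_def root_walk_def splittings_def)
  then have "walk_sum 0 S v L = (\<Sum>W\<in>root_walks S v L. if W = [] then 1 else 0)"
    by (simp add: walk_sum_def)
  also have "\<dots> = (\<Sum>W\<in>root_walks S v L \<inter> {[]}. 1)"
  proof (cases "finite (root_walks S v L)")
    case True
    then show ?thesis by (subst sum.inter_restrict) (auto intro!: sum.cong)
  next
    case False
    have "\<not> finite S" using False finite_root_walks[of S v L] by blast
    then have "root_walks S v L = {}" by (auto simp: root_walks_def)
    then show ?thesis by simp
  qed
  also have "root_walks S v L \<inter> {[]} = (if S = {v} \<and> L = 0 then {[]} else {})"
    by (auto simp: root_walks_def root_walk_def)
  finally show ?thesis by simp
qed

text \<open>Taking the difference of consecutive \<open>k\<close> removes the empty walk and leaves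
  a single binomial coefficient as weight, which is the form that
  \<open>splittings_mult_diff\<close> treats.\<close>

lemma walk_sum_Suc:
  assumes "finite S" "v \<in> S"
  shows "walk_sum (Suc k) S v L = walk_sum k S v L +
    (\<Sum>(S2, c)\<in>(SIGMA S2:Pow (S - {v}). S2). \<Sum>(K, L1)\<in>steps L.
       real ((k + K - 1) choose k) * walk_sum (k + K) (S - S2) v L1 * walk_sum K S2 c (L - 2 * K - L1))"
proof -
  define g where "g r = real (splittings (Suc k) r) - real (splittings k r)" for r
  have g0: "g 0 = 0" by (cases k) (simp_all add: g_def splittings_def)
  have "walk_sum (Suc k) S v L - walk_sum k S v L = (\<Sum>W\<in>root_walks S v L. g (count_list W v))"
    by (simp add: walk_sum_def g_def sum_subtractf)
  also have "\<dots> = (\<Sum>(S2, c)\<in>(SIGMA S2:Pow (S - {v}). S2). \<Sum>(K, L1)\<in>steps L.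
       (\<Sum>W\<in>root_walks (S - S2) v L1. real (splittings K (count_list W v)) * g (K + count_list W v)) *
       walk_sum K S2 c (L - 2 * K - L1))"
    by (subst sum_root_walks[OF assms]) (simp add: g0)
  also have "\<dots> = (\<Sum>(S2, c)\<in>(SIGMA S2:Pow (S - {v}). S2). \<Sum>(K, L1)\<in>steps L.
       real ((k + K - 1) choose k) * walk_sum (k + K) (S - S2) v L1 * walk_sum K S2 c (L - 2 * K - L1))"
  proof (intro sum.cong refl, clarify, intro sum.cong refl, clarify)
    fix S2 c K L1 assume "(K, L1) \<in> steps L"
    then have K: "1 \<le> K" by (simp add: steps_def)
    show "(\<Sum>W\<in>root_walks (S - S2) v L1. real (splittings K (count_list W v)) * g (K + count_list W v)) *
       walk_sum K S2 c (L - 2 * K - L1) =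
       real ((k + K - 1) choose k) * walk_sum (k + K) (S - S2) v L1 * walk_sum K S2 c (L - 2 * K - L1)"
      unfolding g_def walk_sum_def[of "k + K"] sum_distrib_left[of "real _"]
      by (simp only: splittings_mult_diff[OF K])
  qed
  finally show ?thesis by simp
qed

text \<open>Product rule for exponential generating functions: there are \<open>j\<close> times
  \<open>card A choose j\<close> pairs with \<open>card B = j\<close>, and the factorials cancel
  this number up to \<open>fact (card A)\<close>.\<close>

lemma sum_pointed_subsets:
  fixes F :: "nat \<Rightarrow> real"
  assumes "finite A"
  shows "(\<Sum>(B, c)\<in>(SIGMA B:Pow A. B). fact (card B - 1) * fact (card A - card B) * F (card B)) =
    fact (card A) * (\<Sum>j=1..card A. F j)"
proof -
  have fin: "finite B" if "B \<in> Pow A" for B using that assms by (auto intro: finite_subset)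
  let ?G = "\<lambda>j. real j * (fact (j - 1) * fact (card A - j) * F j)"
  have "(\<Sum>(B, c)\<in>(SIGMA B:Pow A. B). fact (card B - 1) * fact (card A - card B) * F (card B)) =
      (\<Sum>B\<in>Pow A. ?G (card B))"
    using assms fin by (subst sum.Sigma[symmetric]) auto
  also have "\<dots> = (\<Sum>j\<in>{0..card A}. \<Sum>B\<in>{B \<in> Pow A. card B = j}. ?G (card B))"
    using assms by (intro sum.group[symmetric]) (auto intro: card_mono)
  also have "\<dots> = (\<Sum>j\<in>{0..card A}. real (card A choose j) * ?G j)"
    using n_subsets[OF assms] by (intro sum.cong refl) simp
  also have "\<dots> = (\<Sum>j\<in>{1..card A}. fact (card A) * F j)"
  proof (rule sum.mono_neutral_cong_right)
    show "\<forall>i\<in>{0..card A} - {1..card A}. real (card A choose i) * ?G i = 0" by (auto simp: Suc_le_eq)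
    fix j assume j: "j \<in> {1..card A}"
    have 1: "real j * fact (j - 1) = fact j" using j fact_reduce[of j, where 'a=real] by simp
    have "real (fact j * fact (card A - j) * (card A choose j)) = real (fact (card A))"
      by (subst binomial_fact_lemma) (use j in auto)
    then have 2: "fact j * fact (card A - j) * real (card A choose j) = fact (card A)" by simp
    have "real (card A choose j) * ?G j = (real j * fact (j - 1)) * fact (card A - j) * real (card A choose j) * F j"
      by (simp only: mult_ac)
    then show "real (card A choose j) * ?G j = fact (card A) * F j" by (simp only: 1 2)
  qed auto
  finally show ?thesis by (simp add: sum_distrib_left)
qed

text \<open>The third index is half the length of a walk, the second one its excess.\<close>
function walk_coeff :: "nat \<Rightarrow> nat \<Rightarrow> nat \<Rightarrow> real" where
  "walk_coeff 0 \<xi> l = (if \<xi> = 0 \<and> l = 0 then 1 else 0)"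
| "walk_coeff (Suc k) \<xi> l = walk_coeff k \<xi> l +
     (\<Sum>p\<in>{p. p \<le> \<xi> \<and> p < l}. \<Sum>i\<le>\<xi> - p. \<Sum>l1<l - p.
        real ((k + p) choose k) * walk_coeff (k + Suc p) i l1 * walk_coeff (Suc p) (\<xi> - p - i) (l - Suc p - l1))"
  by pat_completeness auto
text \<open>The first argument grows in the products, but there the half length drops; it is kept
  only in the call with smaller \<open>k\<close>.\<close>

termination by (relation "measures [\<lambda>(k, \<xi>, l). l, \<lambda>(k, \<xi>, l). k]") auto

declare walk_coeff.simps(2) [simp del]

text \<open>A walk of half length \<open>l\<close> and excess \<open>\<xi>\<close> has
  \<open>l + 1 - \<xi>\<close> vertices, at least one. In the recursion the first edge uses
  \<open>p + 1\<close> of the half length but only \<open>p\<close> of the excess, so the surplus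
  passes to one of the factors.\<close>

lemma walk_coeff_eq_0: "\<xi> > l \<Longrightarrow> walk_coeff k \<xi> l = 0"
proof (induction l arbitrary: k \<xi> rule: less_induct)
  case (less l)
  note IH = less.IH
  show ?case
  proof (induction k)
    case (Suc k)
    have "walk_coeff (k + Suc p) i l1 * walk_coeff (Suc p) (\<xi> - p - i) (l - Suc p - l1) = 0"
      if "p \<le> \<xi>" "p < l" "i \<le> \<xi> - p" "l1 < l - p" for p i l1
    proof (cases "i > l1")
      case True
      then show ?thesis using IH[of l1 i "k + Suc p"] that by simp
    next
      case False
      then show ?thesis using IH[of "l - Suc p - l1" "\<xi> - p - i" "Suc p"] that less.prems by simp
    qed
    then have "(\<Sum>p\<in>{p. p \<le> \<xi> \<and> p < l}. \<Sum>i\<le>\<xi> - p. \<Sum>l1<l - p.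
        real ((k + p) choose k) * walk_coeff (k + Suc p) i l1 * walk_coeff (Suc p) (\<xi> - p - i) (l - Suc p - l1)) = 0"
      by (intro sum.neutral ballI) simp
    then show ?case using Suc by (simp only: walk_coeff.simps(2)[of k \<xi> l] add_0)
  qed (use less.prems in simp)
qed

text \<open>Indexed by the number of vertices and the length, and divided by the factorial of the number of non-root vertices.\<close>
definition size_coeff :: "nat \<Rightarrow> nat \<Rightarrow> nat \<Rightarrow> real" where
  "size_coeff k n L = (if even L \<and> n \<le> L div 2 + 1 then walk_coeff k (L div 2 + 1 - n) (L div 2) else 0)"

text \<open>The recursion for \<open>walk_coeff\<close> in other coordinates:
  \<open>K = p + 1\<close> for an edge of excess \<open>p\<close>, \<open>L1 = 2 l1\<close>, and a
  root side of excess \<open>i\<close> has \<open>n - j = l1 + 1 - i\<close> vertices.\<close>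

lemma size_coeff_Suc:
  assumes "n \<ge> 1"
  shows "size_coeff (Suc k) n L = size_coeff k n L +
    (\<Sum>(K, L1)\<in>steps L. \<Sum>j=1..n - 1.
       real ((k + K - 1) choose k) * size_coeff (k + K) (n - j) L1 * size_coeff K j (L - 2 * K - L1))"
proof -
  define F where "F = (\<lambda>((K, L1), j). real ((k + K - 1) choose k) * size_coeff (k + K) (n - j) L1 *
     size_coeff K j (L - 2 * K - L1))"
  define A where "A = steps L \<times> {1..n - 1}"
  define l where "l = L div 2"
  define \<xi> where "\<xi> = l + 1 - n"
  define G where "G = (\<lambda>(p, i, l1). real ((k + p) choose k) * walk_coeff (k + Suc p) i l1 *
     walk_coeff (Suc p) (\<xi> - p - i) (l - Suc p - l1))"
  define B where "B = (SIGMA p:{p. p \<le> \<xi> \<and> p < l}. {..\<xi> - p} \<times> {..<l - p})"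
  have lhs: "(\<Sum>(K, L1)\<in>steps L. \<Sum>j=1..n - 1.
       real ((k + K - 1) choose k) * size_coeff (k + K) (n - j) L1 * size_coeff K j (L - 2 * K - L1)) = sum F A"
    unfolding A_def F_def by (subst sum.cartesian_product[symmetric]) (simp add: case_prod_unfold)
  have G: "(\<Sum>p\<in>{p. p \<le> \<xi> \<and> p < l}. \<Sum>i\<le>\<xi> - p. \<Sum>l1<l - p.
        real ((k + p) choose k) * walk_coeff (k + Suc p) i l1 * walk_coeff (Suc p) (\<xi> - p - i) (l - Suc p - l1)) = sum G B"
    unfolding B_def G_def by (subst sum.Sigma[symmetric]) (auto simp: sum.cartesian_product)
  \<comment> \<open>The two index ranges correspond only where the summands are nonzero; a nonzero
    summand forces even lengths and admissible vertex counts.\<close>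
  have nz: "even (snd (fst x)) \<and> even L \<and> n - snd x \<le> snd (fst x) div 2 + 1 \<and>
      snd x \<le> (L - 2 * fst (fst x) - snd (fst x)) div 2 + 1 \<and>
      1 \<le> fst (fst x) \<and> 2 * fst (fst x) + snd (fst x) \<le> L \<and> 1 \<le> snd x \<and> snd x \<le> n - 1" if "x \<in> A" "F x \<noteq> 0" for x
  proof -
    obtain K L1 j where x: "x = ((K, L1), j)" by (metis prod.collapse)
    have "size_coeff (k + K) (n - j) L1 \<noteq> 0" "size_coeff K j (L - 2 * K - L1) \<noteq> 0"
      using that by (auto simp: F_def x)
    moreover have "1 \<le> K" "2 * K + L1 \<le> L" "1 \<le> j" "j \<le> n - 1" using that by (auto simp: A_def x steps_def)
    ultimately show ?thesis unfolding size_coeff_def by (auto simp: x split: if_splits)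
  qed
  show ?thesis
  proof (cases "even L \<and> n \<le> l + 1")
    case False
    have "F x = 0" if "x \<in> A" for x
    proof (rule ccontr)
      assume "F x \<noteq> 0"
      note * = nz[OF that this]
      have "even L" "even (snd (fst x))" using * by auto
      then obtain a b where ab: "L = 2 * a" "snd (fst x) = 2 * b" by (elim evenE)
      have "L - 2 * fst (fst x) - snd (fst x) = 2 * (a - fst (fst x) - b)"
        unfolding ab by (simp add: diff_mult_distrib2)
      then have "snd x \<le> a - fst (fst x) - b + 1" "n - snd x \<le> b + 1" "n > a + 1"
        "1 \<le> fst (fst x)" "fst (fst x) + b \<le> a"
        using * False by (simp_all add: l_def ab)
      then show False by linarith
    qed
    then have "sum F A = 0" by simp
    then show ?thesis unfolding lhs using False by (auto simp: size_coeff_def l_def)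
  next
    case True
    then have L: "L = 2 * l" "n \<le> l + 1" by (auto simp: l_def)
    define to_B where "to_B = (\<lambda>((K :: nat, L1), j). (K - 1, L1 div 2 + 1 - (n - j), L1 div 2))"
    define from_B where "from_B = (\<lambda>(p, i, l1). ((Suc p, 2 * l1), n + i - (l1 + 1)))"
    have "sum F {x \<in> A. F x \<noteq> 0} = sum G {y \<in> B. G y \<noteq> 0}"
    proof (rule sum.reindex_bij_witness[where
          j = to_B and i = from_B])
      fix x assume x0: "x \<in> {x \<in> A. F x \<noteq> 0}"
      obtain K L1 j where x: "x = ((K, L1), j)" by (metis prod.collapse)
      have n: "even L1" "n - j \<le> L1 div 2 + 1" "j \<le> (L - 2 * K - L1) div 2 + 1"
         "1 \<le> K" "2 * K + L1 \<le> L" "1 \<le> j" "j \<le> n - 1"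
        using nz[of x] x0 by (auto simp: x)
      obtain l1 where l1: "L1 = 2 * l1" using n(1) by (elim evenE)
      obtain p where p: "K = Suc p" using n(4) by (cases K) auto
      have e: "(L - 2 * K - L1) div 2 = l - Suc p - l1" "L - 2 * K - L1 = 2 * (l - Suc p - l1)"
        unfolding l1 p L by (simp_all add: diff_mult_distrib2)
      have n': "n - j \<le> l1 + 1" "j \<le> l - Suc p - l1 + 1" "Suc p + l1 \<le> l" "1 \<le> j" "j \<le> n - 1"
        using n unfolding e by (auto simp: l1 p L)
      show "from_B (to_B x) = x"
        using n' by (simp add: x p l1 from_B_def to_B_def)
      have inB: "(p, l1 + 1 - (n - j), l1) \<in> B"
        using n' L(2) by (auto simp: B_def \<xi>_def)
      have "\<xi> - p - (l1 + 1 - (n - j)) = l - Suc p - l1 + 1 - j" using n' L(2) by (simp add: \<xi>_def)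
      then have FG: "F x = G (p, l1 + 1 - (n - j), l1)"
        unfolding x F_def G_def split_conv size_coeff_def e using n' by (simp add: p l1)
      have J: "to_B x = (p, l1 + 1 - (n - j), l1)"
        by (simp add: x p l1 to_B_def)
      show "to_B x \<in> {y \<in> B. G y \<noteq> 0}"
        unfolding J using inB x0 FG by simp
      show "G (to_B x) = F x"
        unfolding J using FG by simp
    next
      fix y assume y0: "y \<in> {y \<in> B. G y \<noteq> 0}"
      obtain p i l1 where y: "y = (p, i, l1)" by (metis prod.collapse)
      have b: "p \<le> \<xi>" "p < l" "i \<le> \<xi> - p" "l1 < l - p" using y0 by (auto simp: y B_def)
      have "walk_coeff (k + Suc p) i l1 \<noteq> 0" "walk_coeff (Suc p) (\<xi> - p - i) (l - Suc p - l1) \<noteq> 0"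
        using y0 by (auto simp: y G_def)
      then have c: "i \<le> l1" "\<xi> - p - i \<le> l - Suc p - l1" using walk_coeff_eq_0 by (meson not_less)+
      show "to_B (from_B y) = y"
        using b c L(2) assms by (simp add: y \<xi>_def from_B_def to_B_def)
      have inA: "((Suc p, 2 * l1), n + i - (l1 + 1)) \<in> A"
        using b c L assms by (auto simp: A_def steps_def \<xi>_def)
      have e: "(L - 2 * Suc p - 2 * l1) div 2 = l - Suc p - l1" "L - 2 * Suc p - 2 * l1 = 2 * (l - Suc p - l1)"
        unfolding L by (simp_all add: diff_mult_distrib2)
      have f: "l1 + 1 - (n - (n + i - (l1 + 1))) = i" "l - Suc p - l1 + 1 - (n + i - (l1 + 1)) = \<xi> - p - i"
         "n - (n + i - (l1 + 1)) \<le> l1 + 1" "n + i - (l1 + 1) \<le> l - Suc p - l1 + 1"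
        using b c L(2) assms by (auto simp: \<xi>_def)
      have "F ((Suc p, 2 * l1), n + i - (l1 + 1)) = G y"
        unfolding y F_def G_def split_conv size_coeff_def e using f by simp
      then show "from_B y \<in> {x \<in> A. F x \<noteq> 0}"
        using inA y0 by (simp add: y from_B_def)
    qed
    moreover have "sum F {x \<in> A. F x \<noteq> 0} = sum F A"
      by (rule sum.mono_neutral_left) (auto simp: A_def)
    moreover have "sum G {y \<in> B. G y \<noteq> 0} = sum G B"
      by (rule sum.mono_neutral_left) (auto simp: B_def)
    ultimately have "sum F A = sum G B" by simp
    moreover have "walk_coeff (Suc k) \<xi> l = walk_coeff k \<xi> l + sum G B"
      by (subst walk_coeff.simps(2)) (simp only: G)
    ultimately show ?thesis unfolding lhs using True
      by (simp add: size_coeff_def \<xi>_def flip: l_def)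
  qed
qed

text \<open>The factorial counts the labellings of the non-root vertices; the choice of the far
  component and of its root is absorbed by \<open>sum_pointed_subsets\<close>. The inner induction
  on \<open>k\<close> handles the term of unchanged length.\<close>

lemma walk_sum_eq_size_coeff:
  assumes "finite S" "v \<in> S"
  shows "walk_sum k S v L = fact (card S - 1) * size_coeff k (card S) L"
  using assms
proof (induction L arbitrary: k S v rule: less_induct)
  case (less L)
  note IH = less.IH
  have S: "finite S" "v \<in> S" using less.prems by auto
  then have card: "card S \<ge> 1" by (simp add: Suc_le_eq card_gt_0_iff) auto
  show ?case
  proof (induction k)
    case 0
    have "S = {v} \<longleftrightarrow> card S = 1" using S by (auto simp: card_1_singleton_iff)
    then show ?case using S card by (auto simp: walk_sum_0 size_coeff_def elim!: evenE)
  next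
    case (Suc k)
    let ?m = "card S - 1"
    have cA: "card (S - {v}) = ?m" using S by simp
    define R where "R j = (\<Sum>(K, L1)\<in>steps L. real ((k + K - 1) choose k) *
       size_coeff (k + K) (card S - j) L1 * size_coeff K j (L - 2 * K - L1))" for j
    have "(\<Sum>(S2, c)\<in>(SIGMA S2:Pow (S - {v}). S2). \<Sum>(K, L1)\<in>steps L.
       real ((k + K - 1) choose k) * walk_sum (k + K) (S - S2) v L1 * walk_sum K S2 c (L - 2 * K - L1)) =
       (\<Sum>(S2, c)\<in>(SIGMA S2:Pow (S - {v}). S2). fact (card S2 - 1) * fact (card (S - {v}) - card S2) * R (card S2))"
    proof (intro sum.cong refl, clarify)
      fix S2 c assume S2: "S2 \<subseteq> S - {v}" "c \<in> S2"
      have fin: "finite S2" "finite (S - S2)" using S2 S finite_subset by auto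
      have cd: "card (S - S2) = card S - card S2" using S2 fin by (intro card_Diff_subset) auto
      have *: "walk_sum (k + K) (S - S2) v L1 = fact (?m - card S2) * size_coeff (k + K) (card S - card S2) L1"
        "walk_sum K S2 c (L - 2 * K - L1) = fact (card S2 - 1) * size_coeff K (card S2) (L - 2 * K - L1)"
        if A: "(K, L1) \<in> steps L" for K L1
      proof -
        have "L1 < L" "L - 2 * K - L1 < L" using A by (auto simp: steps_def)
        then show "walk_sum (k + K) (S - S2) v L1 = fact (?m - card S2) * size_coeff (k + K) (card S - card S2) L1"
        "walk_sum K S2 c (L - 2 * K - L1) = fact (card S2 - 1) * size_coeff K (card S2) (L - 2 * K - L1)"
          using IH[of L1 "S - S2" v "k + K"] IH[of "L - 2 * K - L1" S2 c K] fin S S2 cd by (auto simp: diff_right_commute)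
      qed
      show "(\<Sum>(K, L1)\<in>steps L. real ((k + K - 1) choose k) * walk_sum (k + K) (S - S2) v L1 *
          walk_sum K S2 c (L - 2 * K - L1)) = fact (card S2 - 1) * fact (card (S - {v}) - card S2) * R (card S2)"
        unfolding R_def sum_distrib_left cA
        by (intro sum.cong refl, clarify, subst *, assumption, subst *, assumption) (simp add: mult_ac)
    qed
    also have "\<dots> = fact ?m * (\<Sum>j=1..?m. R j)"
      using sum_pointed_subsets[of "S - {v}" R] S by (simp add: cA)
    also have "(\<Sum>j=1..?m. R j) = (\<Sum>(K, L1)\<in>steps L. \<Sum>j=1..card S - 1. real ((k + K - 1) choose k) *
       size_coeff (k + K) (card S - j) L1 * size_coeff K j (L - 2 * K - L1))"
      unfolding R_def by (subst sum.swap) (simp add: case_prod_unfold)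
    finally show ?case
      unfolding walk_sum_Suc[OF S] size_coeff_Suc[OF card] Suc by (simp add: distrib_left)
  qed
qed

text \<open>The \<open>m\<close> choices of the root turn \<open>fact (m - 1)\<close> into
  \<open>fact m\<close>, and one block leaves no choice of cuts. For \<open>m = 0\<close> the excess
  index exceeds the half length.\<close>

lemma w_eq_size_coeff: "real (w m L) = fact m * size_coeff 1 m L"
proof (cases "m = 0")
  case True
  have "w 0 L = 0" by (simp add: w_def tree_walk_iff)
  moreover have "walk_coeff k (Suc l) l = 0" for k l by (rule walk_coeff_eq_0) simp
  ultimately show ?thesis using True by (simp add: size_coeff_def)
next
  case False
  have "{W. tree_walk m W \<and> length W = L} = (\<Union>v\<in>{1..m}. root_walks {1..m} v L)"
    by (auto simp: tree_walk_iff root_walks_def)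
  moreover have "root_walks {1..m} v L \<inter> root_walks {1..m} v' L = {}" if "v \<noteq> v'" for v v'
  proof -
    have "v = v'" if W: "W \<in> root_walks {1..m} v L" "W \<in> root_walks {1..m} v' L" for W
      using W by (cases W) (auto simp: root_walks_def root_walk_def)
    then show ?thesis using that by blast
  qed
  ultimately have "w m L = (\<Sum>v\<in>{1..m}. card (root_walks {1..m} v L))"
    unfolding w_def using finite_root_walks[of "{1..m}"] by (simp add: card_UN_disjoint)
  moreover have "real (card (root_walks {1..m} v L)) = walk_sum 1 {1..m} v L" for v
    by (simp add: walk_sum_def splittings_def)
  ultimately have "real (w m L) = (\<Sum>v\<in>{1..m}. walk_sum 1 {1..m} v L)" by simp
  also have "\<dots> = (\<Sum>v\<in>{1..m}. fact (m - 1) * size_coeff 1 m L)"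
    by (intro sum.cong refl) (subst walk_sum_eq_size_coeff; simp)
  also have "\<dots> = fact m * size_coeff 1 m L"
    using False fact_reduce[of m, where 'a=real] by simp
  finally show ?thesis .
qed

section \<open>Generating functions in \<open>z\<close> for fixed block number and excess\<close>

definition walk_fps :: "nat \<Rightarrow> nat \<Rightarrow> real fps" where
  "walk_fps k \<xi> = Abs_fps (walk_coeff k \<xi>)"

lemma W_fps_eq: "W_fps \<xi> = walk_fps 1 \<xi>"
proof (rule fps_ext)
  fix l
  show "W_fps \<xi> $ l = walk_fps 1 \<xi> $ l"
  proof (cases "l + 1 < \<xi>")
    case True
    then show ?thesis by (simp add: W_fps_def walk_fps_def walk_coeff_eq_0)
  next
    case False
    then show ?thesis
      by (simp add: W_fps_def walk_fps_def w_eq_size_coeff size_coeff_def)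
  qed
qed

lemma walk_fps_0: "walk_fps 0 \<xi> = (if \<xi> = 0 then 1 else 0)"
proof (rule fps_ext)
  fix l show "walk_fps 0 \<xi> $ l = (if \<xi> = 0 then 1 else 0) $ l"
    by (cases "\<xi> = 0") (simp_all add: walk_fps_def)
qed

lemma walk_fps_Suc:
  "walk_fps (Suc k) \<xi> = walk_fps k \<xi> + (\<Sum>p\<le>\<xi>. fps_const (real ((k + p) choose k)) * (fps_X ^ Suc p *
     (\<Sum>i\<le>\<xi> - p. walk_fps (k + Suc p) i * walk_fps (Suc p) (\<xi> - p - i))))"
proof (rule fps_ext)
  fix l
  define t where "t p = (\<Sum>i\<le>\<xi> - p. \<Sum>l1<l - p. real ((k + p) choose k) * walk_coeff (k + Suc p) i l1 *
       walk_coeff (Suc p) (\<xi> - p - i) (l - Suc p - l1))" for p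
  have summand: "(fps_const (real ((k + p) choose k)) * (fps_X ^ Suc p *
      (\<Sum>i\<le>\<xi> - p. walk_fps (k + Suc p) i * walk_fps (Suc p) (\<xi> - p - i)))) $ l =
    (if p < l then t p else 0)" for p
  proof (cases "p < l")
    case True
    then have e: "{0..l - Suc p} = {..<l - p}" by auto
    show ?thesis
      unfolding fps_mult_left_const_nth fps_X_power_mult_nth
      unfolding fps_sum_nth fps_mult_nth walk_fps_def
      using True by (simp add: e t_def sum_distrib_left mult.assoc del: of_nat_Suc)
  next
    case False
    then show ?thesis
      unfolding fps_mult_left_const_nth fps_X_power_mult_nth by simp
  qed
  have "walk_fps (Suc k) \<xi> $ l = walk_fps k \<xi> $ l + (\<Sum>p\<in>{p. p \<le> \<xi> \<and> p < l}. t p)"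
    unfolding walk_fps_def fps_nth_Abs_fps t_def by (rule walk_coeff.simps(2))
  also have "(\<Sum>p\<in>{p. p \<le> \<xi> \<and> p < l}. t p) = (\<Sum>p\<le>\<xi>. if p < l then t p else 0)"
    by (rule sum.mono_neutral_cong_left) auto
  finally show "walk_fps (Suc k) \<xi> $ l = (walk_fps k \<xi> + (\<Sum>p\<le>\<xi>. fps_const (real ((k + p) choose k)) * (fps_X ^ Suc p *
     (\<Sum>i\<le>\<xi> - p. walk_fps (k + Suc p) i * walk_fps (Suc p) (\<xi> - p - i))))) $ l"
    unfolding fps_add_nth fps_sum_nth[of _ "{..\<xi>}"] summand .
qed

section \<open>Renormalised generating functions\<close>

text \<open>The formal sum of \<open>F p * X ^ p\<close> over all \<open>p\<close>.\<close>
definition fps_series :: "(nat \<Rightarrow> 'a::comm_ring_1 fps) \<Rightarrow> 'a fps" where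
  "fps_series F = Abs_fps (\<lambda>n. \<Sum>p\<le>n. F p $ (n - p))"

lemma fps_series_nth: "fps_series F $ n = (\<Sum>p\<le>n. F p $ (n - p))"
  by (simp add: fps_series_def)

lemma fps_series_nth_partial:
  assumes "m \<le> N"
  shows "fps_series F $ m = (\<Sum>p\<le>N. fps_X ^ p * F p) $ m"
proof -
  have "(\<Sum>p\<le>N. fps_X ^ p * F p) $ m = (\<Sum>p\<le>N. if m < p then 0 else F p $ (m - p))"
    by (simp add: fps_sum_nth fps_X_power_mult_nth)
  also have "\<dots> = (\<Sum>p\<le>m. F p $ (m - p))"
    using assms by (intro sum.mono_neutral_cong_right) auto
  finally show ?thesis by (simp add: fps_series_nth)
qed

lemma fps_series_mult: "g * fps_series F = fps_series (\<lambda>p. g * F p)"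
proof (rule fps_ext)
  fix n
  have "(g * fps_series F) $ n = (\<Sum>i=0..n. g $ i * (\<Sum>p\<le>n. fps_X ^ p * F p) $ (n - i))"
    unfolding fps_mult_nth by (intro sum.cong refl arg_cong2[of _ _ _ _ "(*)"] fps_series_nth_partial) simp
  also have "\<dots> = (g * (\<Sum>p\<le>n. fps_X ^ p * F p)) $ n"
    by (rule fps_mult_nth[symmetric])
  also have "\<dots> = (\<Sum>p\<le>n. fps_X ^ p * (g * F p)) $ n"
    by (simp add: sum_distrib_left mult_ac)
  also have "\<dots> = fps_series (\<lambda>p. g * F p) $ n" by (rule fps_series_nth_partial[symmetric]) simp
  finally show "(g * fps_series F) $ n = fps_series (\<lambda>p. g * F p) $ n" .
qed

lemma fps_series_Suc: "fps_series F = F 0 + fps_X * fps_series (\<lambda>p. F (Suc p))"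
proof (rule fps_ext)
  fix n show "fps_series F $ n = (F 0 + fps_X * fps_series (\<lambda>p. F (Suc p))) $ n"
    by (cases n) (simp_all add: fps_series_nth sum.atMost_Suc_shift del: sum.atMost_Suc)
qed

text \<open>The formal variable marks the excess and \<open>z\<close> is an element of the
  coefficient field, which has to allow division by \<open>x\<close>. The assumption
  \<open>b_1_0\<close> fixes which root of the quadratic equation for \<open>c\<close> is
  meant.\<close>

locale walk_recursion =
  fixes b :: "nat \<Rightarrow> 'a::field fps" and z s c x Y :: 'a
  assumes b_0: "b 0 = 1"
    and b_Suc: "b (Suc k) = b k + fps_series (\<lambda>p.
       fps_const (of_nat ((k + p) choose k) * z ^ Suc p * s ^ p) * (b (k + Suc p) * b (Suc p)))"
    and c_eq: "c = 1 + z * c\<^sup>2"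
    and b_1_0: "b 1 $ 0 = c"
    and x_eq: "x = z * c\<^sup>2"
    and nonzero: "c \<noteq> 0" "x \<noteq> 0" "x \<noteq> 1"
    and Y_eq: "Y = (1 - x) / x"
    and s_eq: "s = Y\<^sup>2 / x\<^sup>2"
begin

definition \<omega> :: "'a fps" where "\<omega> = fps_const (1 / c) * b 1 - 1"
definition \<theta> :: "'a fps" where "\<theta> = inverse (1 - fps_const x * \<omega>)"
text \<open>Division by the variable shifts the index by one; this is why the top kernels carry the
  Catalan number of \<open>\<xi> - 1\<close>.\<close>

definition \<psi> :: "'a fps" where "\<psi> = fps_const (x / Y) * fps_shift 1 \<omega>"
text \<open>Each step in \<open>k\<close> contributes the factor
  \<open>1 - z b 1 = (1 - x \<omega>) / c\<close>, obtained by solving for \<open>b (k + 1)\<close>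
  in the summand \<open>p = 0\<close>; \<open>B\<close> absorbs these factors.\<close>

definition B :: "nat \<Rightarrow> 'a fps" where "B k = fps_const (1 / c ^ k) * (1 - fps_const x * \<omega>) ^ k * b k"

lemma Y_nonzero: "Y \<noteq> 0"
  using nonzero by (simp add: Y_eq)

lemma x_inverse: "x * (1 + Y) = 1"
  using nonzero by (simp add: Y_eq field_simps)

lemma one_plus_Y: "1 + Y = 1 / x"
  using x_inverse nonzero by (simp add: eq_divide_eq mult.commute)

lemma \<omega>_0: "\<omega> $ 0 = 0"
  using b_1_0 nonzero by (simp add: \<omega>_def)

lemma \<theta>_inverse: "\<theta> * (1 - fps_const x * \<omega>) = 1"
  unfolding \<theta>_def by (rule inverse_mult_eq_1) (simp add: \<omega>_0)

lemma \<omega>_eq: "\<omega> = fps_const (Y / x) * (fps_X * \<psi>)"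
proof -
  have "\<omega> = fps_X * fps_shift 1 \<omega>"
    by (rule fps_ext) (auto simp: \<omega>_0 not_less_eq less_Suc_eq)
  moreover have "fps_const (Y / x) * (fps_X * \<psi>) = fps_const (Y / x * (x / Y)) * (fps_X * fps_shift 1 \<omega>)"
    unfolding \<psi>_def fps_const_mult[symmetric] by (simp only: mult_ac)
  ultimately show ?thesis using nonzero Y_nonzero by simp
qed

lemma fps_const_x_\<omega>: "fps_const x * \<omega> = fps_const Y * (fps_X * \<psi>)"
proof -
  have "fps_const x * fps_const (Y / x) = fps_const Y" using nonzero by simp
  then show ?thesis by (simp add: \<omega>_eq flip: mult.assoc)
qed

lemma B_0: "B 0 = 1"
  by (simp add: B_def b_0)

lemma b_eq: "b k = fps_const (c ^ k) * \<theta> ^ k * B k"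
proof -
  have "fps_const (c ^ k) * \<theta> ^ k * B k =
      (fps_const (c ^ k) * fps_const (1 / c ^ k)) * (\<theta> * (1 - fps_const x * \<omega>)) ^ k * b k"
    unfolding B_def power_mult_distrib by (simp only: mult_ac)
  then show ?thesis using nonzero by (simp add: \<theta>_inverse)
qed

text \<open>With \<open>s = Y^2 (1 + Y)^2\<close> and \<open>x (1 + Y) = 1\<close>, the factor
  \<open>x^(p + 2)\<close> cancels all but \<open>p\<close> of the \<open>2 p + 2\<close> powers of
  \<open>1 + Y\<close>. Thus no denominator is left.\<close>

lemma coefficient_eq: "z ^ (p + 2) * s ^ (p + 1) * c ^ (2 * p + 4) = Y ^ (2 * p + 2) * (1 + Y) ^ p"
proof -
  have "2 * p + 4 = 2 * (p + 2)" by simp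
  then have "c ^ (2 * p + 4) = (c\<^sup>2) ^ (p + 2)" by (simp only: power_mult)
  then have "z ^ (p + 2) * s ^ (p + 1) * c ^ (2 * p + 4) = (z * c\<^sup>2) ^ (p + 2) * s ^ (p + 1)"
    unfolding power_mult_distrib by (simp only: mult_ac)
  also have "\<dots> = x ^ (p + 2) * s ^ (p + 1)" by (simp add: x_eq)
  also have "\<dots> = (x ^ (p + 2) * (1 + Y) ^ (p + 2)) * (Y ^ (2 * p + 2) * (1 + Y) ^ p)"
  proof -
    have "s = Y\<^sup>2 * (1 + Y)\<^sup>2"
      unfolding s_eq one_plus_Y by (simp add: power_divide)
    moreover have "2 * p + 2 = 2 * (p + 1)" by simp
    ultimately have "s ^ (p + 1) = Y ^ (2 * p + 2) * (1 + Y) ^ (2 * p + 2)"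
      by (simp only: power_mult_distrib power_mult)
    also have "2 * p + 2 = (p + 2) + p" by simp
    then have "(1 + Y) ^ (2 * p + 2) = (1 + Y) ^ (p + 2) * (1 + Y) ^ p"
      by (simp only: power_add)
    finally show ?thesis by (simp only: mult_ac)
  qed
  also have "x ^ (p + 2) * (1 + Y) ^ (p + 2) = 1" unfolding power_mult_distrib[symmetric] x_inverse by simp
  finally show ?thesis by simp
qed

text \<open>The index \<open>p\<close> is shifted by one because the summand \<open>p = 0\<close>
  has moved into the normalisation. All powers of \<open>c\<close> and of \<open>\<theta>\<close>
  that depend on \<open>k\<close> cancel.\<close>

lemma B_Suc:
  "B (Suc k) = B k + fps_X * fps_series (\<lambda>p.
     fps_const (of_nat ((k + Suc p) choose k) * (Y ^ (2 * p + 2) * (1 + Y) ^ p)) *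
       (\<theta> ^ (2 * p + 4) * (B (k + p + 2) * B (p + 2))))"
proof -
  define D where "D = 1 - fps_const x * \<omega>"
  define F where "F p = fps_const (of_nat ((k + p) choose k) * z ^ Suc p * s ^ p) * (b (k + Suc p) * b (Suc p))" for p
  have \<theta>D: "\<theta> * D = 1" using \<theta>_inverse by (simp add: D_def)
  have D: "D = fps_const c * (1 - fps_const z * b 1)"
  proof -
    have "D = 1 + fps_const x - fps_const x * fps_const (1 / c) * b 1"
      by (simp add: D_def \<omega>_def algebra_simps)
    also have "1 + fps_const x = fps_const c" using c_eq by (simp add: x_eq flip: fps_const_1_eq_1)
    also have "fps_const x * fps_const (1 / c) = fps_const (c * z)"
      using nonzero by (simp add: x_eq power2_eq_square)
    finally show ?thesis by (simp add: right_diff_distrib flip: mult.assoc)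
  qed
  have "b (Suc k) = b k + fps_series F"
    unfolding F_def by (rule b_Suc)
  also have "fps_series F = fps_const z * (b (Suc k) * b 1) + fps_X * fps_series (\<lambda>p. F (Suc p))"
  proof -
    have "F 0 = fps_const z * (b (Suc k) * b 1)" by (simp add: F_def)
    then show ?thesis using fps_series_Suc[of F] by (simp only:)
  qed
  finally have "b (Suc k) * (1 - fps_const z * b 1) = b k + fps_X * fps_series (\<lambda>p. F (Suc p))"
    by (simp add: algebra_simps)
  moreover have "1 - fps_const z * b 1 = fps_const (1 / c) * D"
    unfolding D mult.assoc[symmetric] using nonzero by simp
  ultimately have eq: "b (Suc k) * (fps_const (1 / c) * D) = b k + fps_X * fps_series (\<lambda>p. F (Suc p))" by (simp only:)
  define g where "g = fps_const (1 / c ^ k) * D ^ k"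
  have "B (Suc k) = g * (b (Suc k) * (fps_const (1 / c) * D))"
  proof -
    have "fps_const (1 / c ^ Suc k) = fps_const (1 / c ^ k) * fps_const (1 / c)" by simp
    then show ?thesis by (simp only: B_def g_def D_def power_Suc mult_ac)
  qed
  also have "\<dots> = B k + fps_X * (g * fps_series (\<lambda>p. F (Suc p)))"
    unfolding eq by (simp add: B_def g_def D_def algebra_simps)
  also have "g * fps_series (\<lambda>p. F (Suc p)) = fps_series (\<lambda>p. g * F (Suc p))"
    by (rule fps_series_mult)
  also have "(\<lambda>p. g * F (Suc p)) = (\<lambda>p. fps_const (of_nat ((k + Suc p) choose k) * (Y ^ (2 * p + 2) * (1 + Y) ^ p)) *
       (\<theta> ^ (2 * p + 4) * (B (k + p + 2) * B (p + 2))))"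
  proof
    fix p
    let ?n = "of_nat ((k + Suc p) choose k) :: 'a"
    have "F (Suc p) = fps_const (?n * z ^ (p + 2) * s ^ (p + 1)) * (b (k + p + 2) * b (p + 2))"
      by (simp add: F_def)
    also have "b (k + p + 2) * b (p + 2) = fps_const (c ^ k * c ^ (2 * p + 4)) * \<theta> ^ k * \<theta> ^ (2 * p + 4) * (B (k + p + 2) * B (p + 2))"
    proof -
      have i: "k + p + 2 + (p + 2) = k + (2 * p + 4)" by simp
      have e: "c ^ (k + p + 2) * c ^ (p + 2) = c ^ k * c ^ (2 * p + 4)"
        "\<theta> ^ (k + p + 2) * \<theta> ^ (p + 2) = \<theta> ^ k * \<theta> ^ (2 * p + 4)"
        by (simp_all only: power_add[symmetric] i)
      have "b (k + p + 2) * b (p + 2) = (fps_const (c ^ (k + p + 2)) * fps_const (c ^ (p + 2))) *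
         (\<theta> ^ (k + p + 2) * \<theta> ^ (p + 2)) * (B (k + p + 2) * B (p + 2))"
        unfolding b_eq[of "k + p + 2"] b_eq[of "p + 2"] by (simp only: mult_ac)
      then show ?thesis unfolding fps_const_mult e by (simp only: mult_ac)
    qed
    finally have "g * F (Suc p) = (fps_const (1 / c ^ k) * fps_const (?n * z ^ (p + 2) * s ^ (p + 1)) * fps_const (c ^ k * c ^ (2 * p + 4))) *
       (\<theta> * D) ^ k * (\<theta> ^ (2 * p + 4) * (B (k + p + 2) * B (p + 2)))"
      unfolding g_def power_mult_distrib by (simp only: mult_ac)
    also have "fps_const (1 / c ^ k) * fps_const (?n * z ^ (p + 2) * s ^ (p + 1)) * fps_const (c ^ k * c ^ (2 * p + 4)) =
       fps_const (?n * (z ^ (p + 2) * s ^ (p + 1) * c ^ (2 * p + 4)))"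
      unfolding fps_const_mult using nonzero by (intro arg_cong[of _ _ fps_const]) (simp add: mult_ac)
    finally show "g * F (Suc p) = fps_const (?n * (Y ^ (2 * p + 2) * (1 + Y) ^ p)) *
       (\<theta> ^ (2 * p + 4) * (B (k + p + 2) * B (p + 2)))"
      unfolding coefficient_eq \<theta>D by simp
  qed
  finally show ?thesis .
qed

lemma \<theta>_eq: "\<theta> = 1 + fps_const Y * (fps_X * (\<psi> * \<theta>))"
  using \<theta>_inverse unfolding fps_const_x_\<omega> by (simp add: algebra_simps)

text \<open>Two expressions for \<open>B 1\<close> are compared: the recursion from
  \<open>B 0 = 1\<close>, and \<open>(1 + \<omega>) (1 - x \<omega>)\<close>. The common factor of
  the variable and \<open>Y^2\<close> is then cancelled.\<close>

lemma \<psi>_eq: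
  "\<psi> = fps_const (1 + Y) * (fps_X * \<psi>\<^sup>2) + fps_series (\<lambda>p.
     fps_const (Y ^ (2 * p) * (1 + Y) ^ p) * (\<theta> ^ (2 * p + 4) * (B (p + 2))\<^sup>2))"
proof -
  define T where "T = fps_series (\<lambda>p. fps_const (Y ^ (2 * p) * (1 + Y) ^ p) * (\<theta> ^ (2 * p + 4) * (B (p + 2))\<^sup>2))"
  have T: "fps_series (\<lambda>p. fps_const (of_nat ((0 + Suc p) choose 0) * (Y ^ (2 * p + 2) * (1 + Y) ^ p)) *
       (\<theta> ^ (2 * p + 4) * (B (0 + p + 2) * B (p + 2)))) = fps_const (Y\<^sup>2) * T"
    unfolding T_def fps_series_mult
    by (intro arg_cong[of _ _ fps_series] ext) (simp add: power2_eq_square power_add mult_ac flip: fps_const_mult)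
  have "B 1 = 1 + fps_X * (fps_const (Y\<^sup>2) * T)"
    using B_Suc[of 0] unfolding T B_0 One_nat_def[symmetric] .
  moreover have "B 1 = (1 + \<omega>) * (1 - fps_const x * \<omega>)"
    by (simp add: B_def \<omega>_def mult_ac)
  ultimately have "fps_X * (fps_const (Y\<^sup>2) * T) = fps_const (1 - x) * \<omega> - fps_const x * \<omega> * \<omega>"
    by (simp add: algebra_simps flip: fps_const_sub)
  also have "fps_const (1 - x) * \<omega> = fps_X * (fps_const (Y\<^sup>2) * \<psi>)"
  proof -
    have "(1 - x) * (Y / x) = Y\<^sup>2" using nonzero by (simp add: Y_eq power2_eq_square)
    then have "fps_const (1 - x) * fps_const (Y / x) = fps_const (Y\<^sup>2)" by simp
    then show ?thesis unfolding \<omega>_eq by (metis mult.assoc mult.commute)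
  qed
  also have "fps_const x * \<omega> * \<omega> = fps_X * (fps_const (Y\<^sup>2) * (fps_const (1 + Y) * (fps_X * \<psi>\<^sup>2)))"
  proof -
    have "Y * (Y / x) = Y\<^sup>2 * (1 + Y)" unfolding one_plus_Y by (simp add: power2_eq_square)
    then have "fps_const Y * fps_const (Y / x) = fps_const (Y\<^sup>2) * fps_const (1 + Y)" by simp
    moreover have "fps_const x * \<omega> * \<omega> = (fps_const Y * fps_const (Y / x)) * (fps_X * \<psi>) * (fps_X * \<psi>)"
      unfolding fps_const_x_\<omega> by (subst \<omega>_eq) (simp only: mult_ac)
    ultimately show ?thesis by (simp only: power2_eq_square mult_ac)
  qed
  finally have "(fps_X * fps_const (Y\<^sup>2)) * T = (fps_X * fps_const (Y\<^sup>2)) * (\<psi> - fps_const (1 + Y) * (fps_X * \<psi>\<^sup>2))"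
    by (simp only: algebra_simps)
  moreover have "fps_X * fps_const (Y\<^sup>2) \<noteq> 0" using Y_nonzero by simp
  ultimately have "T = \<psi> - fps_const (1 + Y) * (fps_X * \<psi>\<^sup>2)" by (simp only: mult_cancel_left) simp
  then show ?thesis by (simp add: T_def)
qed

end

section \<open>Catalan numbers\<close>

lemma Cat_Suc: "real (n + 2) * Cat (Suc n) = real (4 * n + 2) * Cat n"
proof -
  have 1: "real (n + 1) * real (2 * Suc n choose Suc n) = 2 * real (2 * n + 1) * real (2 * n choose n)"
  proof -
    have 1: "Suc n * (Suc (2 * n + 1) choose Suc n) = Suc (2 * n + 1) * (2 * n + 1 choose n)"
      by (rule Suc_times_binomial)
    have 2: "Suc n * (2 * n + 1 choose n) = (2 * n + 1) * (2 * n choose n)"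
    proof -
      have "(2 * n + 1 choose n) = (2 * n + 1 choose Suc n)"
        using binomial_symmetric[of n "2 * n + 1"] by simp
      then show ?thesis using Suc_times_binomial[of n "2 * n"] by (simp only: Suc_eq_plus1)
    qed
    have "Suc n * (2 * Suc n choose Suc n) = 2 * (Suc n * (2 * n + 1 choose n))"
      using 1 by (simp add: mult_ac)
    then have "Suc n * (2 * Suc n choose Suc n) = 2 * ((2 * n + 1) * (2 * n choose n))"
      unfolding 2 .
    from arg_cong[OF this, of real] show ?thesis by (simp only: of_nat_mult of_nat_numeral Suc_eq_plus1 mult_ac)
  qed
  have 2: "real (n + 2) * Cat (Suc n) = real (2 * Suc n choose Suc n)"
    by (simp add: Cat_def del: binomial_Suc_Suc mult_Suc_right)
  have 3: "real (2 * n choose n) = real (n + 1) * Cat n" by (simp add: Cat_def)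
  have "real (4 * n + 2) = 2 * real (2 * n + 1)" by simp
  then have "real (n + 1) * (real (n + 2) * Cat (Suc n)) = real (n + 1) * (real (4 * n + 2) * Cat n)"
    unfolding 2 1 unfolding 3 by (simp only: mult_ac)
  then show ?thesis by (simp only: mult_cancel_left) simp
qed

lemma Cat_0 [simp]: "Cat 0 = 1"
  by (simp add: Cat_def)

text \<open>Both \<open>(1 - 2 X C)\<^sup>2\<close> and \<open>1 - 4 X\<close> solve the same linear differential equation.\<close>
lemma C_fps_eq: "C_fps = 1 + fps_X * C_fps\<^sup>2"
proof -
  define S where "S = 1 - fps_const 2 * (fps_X * C_fps)"
  have S_0: "S $ 0 = 1" by (simp add: S_def)
  have S_Suc: "S $ Suc n = - 2 * Cat n" for n by (simp add: S_def C_fps_def)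
  have ode: "(1 - fps_const 4 * fps_X) * fps_deriv S = - (fps_const 2 * S)"
  proof (rule fps_ext)
    fix n
    have D: "fps_deriv S $ n = - 2 * (real n + 1) * Cat n" for n by (simp add: S_Suc algebra_simps)
    have "((1 - fps_const 4 * fps_X) * fps_deriv S) $ n =
        fps_deriv S $ n - 4 * (if n = 0 then 0 else fps_deriv S $ (n - 1))"
      by (simp add: left_diff_distrib mult.assoc)
    then show "((1 - fps_const 4 * fps_X) * fps_deriv S) $ n = (- (fps_const 2 * S)) $ n"
      unfolding D
    proof (cases n)
      case (Suc m)
      assume "((1 - fps_const 4 * fps_X) * fps_deriv S) $ n =
        - 2 * (real n + 1) * Cat n - 4 * (if n = 0 then 0 else - 2 * (real (n - 1) + 1) * Cat (n - 1))"
      then show ?thesis using Cat_Suc[of m] Suc by (simp add: S_Suc algebra_simps)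
    qed (simp add: S_0)
  qed
  define Q where "Q = S * S - (1 - fps_const 4 * fps_X)"
  have "(1 - fps_const 4 * fps_X) * fps_deriv Q =
      fps_const 2 * S * ((1 - fps_const 4 * fps_X) * fps_deriv S) + fps_const 4 * (1 - fps_const 4 * fps_X)"
    by (simp add: Q_def algebra_simps flip: fps_numeral_fps_const)
  also have "\<dots> = - (fps_const 4 * Q)"
    unfolding ode by (simp add: Q_def algebra_simps flip: fps_numeral_fps_const)
  finally have Q_ode: "(1 - fps_const 4 * fps_X) * fps_deriv Q = - (fps_const 4 * Q)" .
  have "Q $ n = 0" for n
  proof (induction n)
    case 0
    show ?case by (simp add: Q_def S_0)
  next
    case (Suc n)
    have "((1 - fps_const 4 * fps_X) * fps_deriv Q) $ n =
        fps_deriv Q $ n - 4 * (if n = 0 then 0 else fps_deriv Q $ (n - 1))"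
      by (simp add: left_diff_distrib mult.assoc)
    then have "fps_deriv Q $ n - 4 * (if n = 0 then 0 else fps_deriv Q $ (n - 1)) = - 4 * Q $ n"
      unfolding Q_ode by simp
    then show ?case using Suc by (cases n) auto
  qed
  then have "Q = 0" by (simp add: fps_ext)
  then have "fps_const 4 * fps_X * (1 + fps_X * C_fps\<^sup>2 - C_fps) = 0"
    by (simp add: Q_def S_def algebra_simps power2_eq_square flip: fps_numeral_fps_const)
  then show ?thesis by (simp flip: fps_numeral_fps_const)
qed

lemma C_fps_unique:
  assumes "u = 1 + fps_X * u\<^sup>2"
  shows "u = C_fps"
proof -
  have "(u - C_fps) * (1 - fps_X * (u + C_fps)) = 0"
  proof -
    have "u - fps_X * u\<^sup>2 = 1" using assms by (metis add_diff_cancel_right')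
    moreover have "C_fps - fps_X * C_fps\<^sup>2 = 1" using C_fps_eq by (metis add_diff_cancel_right')
    moreover have "(u - C_fps) * (1 - fps_X * (u + C_fps)) = (u - fps_X * u\<^sup>2) - (C_fps - fps_X * C_fps\<^sup>2)"
      by (simp add: algebra_simps power2_eq_square)
    ultimately show ?thesis by simp
  qed
  moreover have "(1 - fps_X * (u + C_fps)) $ 0 = 1" by simp
  then have "1 - fps_X * (u + C_fps) \<noteq> 0" by (metis fps_zero_nth zero_neq_one)
  ultimately show ?thesis by simp
qed

text \<open>Generating function of the coefficients of \<open>Y\<close> at \<open>Y = 0\<close>; it solves the linearisation of the equation
  for \<open>C\<close>.\<close>
definition slope_fps :: "real fps" where
  "slope_fps = fps_const 3 * (fps_X * fps_deriv C_fps) + fps_const 2 * C_fps - fps_const 2"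

lemma slope_fps_nth: "slope_fps $ n = real (3 * n + 2) * Cat n - (if n = 0 then 2 else 0)"
  by (cases n) (simp_all add: slope_fps_def C_fps_def algebra_simps)

text \<open>\<open>3 X\<close> times the derivative of the Catalan equation, combined with twice the
  Catalan equation itself.\<close>

lemma slope_fps_eq:
  "slope_fps = fps_X * (fps_const 2 * C_fps * slope_fps + C_fps\<^sup>2) + fps_const 4 * (fps_X * C_fps)"
proof -
  let ?D = "fps_deriv C_fps"
  have "?D = fps_deriv (1 + fps_X * C_fps\<^sup>2)" using C_fps_eq by simp
  also have "\<dots> = C_fps\<^sup>2 + 2 * (fps_X * C_fps * ?D)"
    by (simp add: power2_eq_square algebra_simps)
  finally have D: "?D - C_fps\<^sup>2 - 2 * (fps_X * C_fps * ?D) = 0"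
    by (metis diff_diff_eq right_minus_eq)
  have C: "1 + fps_X * C_fps\<^sup>2 - C_fps = 0" using C_fps_eq by (metis right_minus_eq)
  have "slope_fps - (fps_X * (fps_const 2 * C_fps * slope_fps + C_fps\<^sup>2) + fps_const 4 * (fps_X * C_fps)) =
      3 * fps_X * (?D - C_fps\<^sup>2 - 2 * (fps_X * C_fps * ?D)) - 2 * (1 + fps_X * C_fps\<^sup>2 - C_fps)"
    by (simp add: slope_fps_def algebra_simps power2_eq_square flip: fps_numeral_fps_const)
  also have "\<dots> = 0" unfolding D C by simp
  finally show ?thesis by simp
qed

section \<open>A cone of polynomials\<close>

text \<open>The exponents of \<open>X\<close> and of \<open>1 + X\<close> are bounded separately:
  the first bound limits the pole at \<open>x = 1\<close>, the second keeps the powers of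
  \<open>x\<close> positive. Products add the bounds.\<close>

inductive_set cone :: "nat \<Rightarrow> real poly set" for n where
  cone_0: "0 \<in> cone n"
| cone_step: "p \<in> cone n \<Longrightarrow> a \<ge> 0 \<Longrightarrow> i \<le> n \<Longrightarrow> j \<le> n \<Longrightarrow>
    p + smult a ([:0, 1:] ^ j * [:1, 1:] ^ i) \<in> cone n"

lemma cone_generator: "a \<ge> 0 \<Longrightarrow> i \<le> n \<Longrightarrow> j \<le> n \<Longrightarrow> smult a ([:0, 1:] ^ j * [:1, 1:] ^ i) \<in> cone n"
  using cone_step[OF cone_0, of a i n j] by simp

lemma cone_add:
  assumes "p \<in> cone n" "q \<in> cone n"
  shows "p + q \<in> cone n"
  using assms(2) by (induction rule: cone.induct) (auto simp: assms(1) simp flip: add.assoc intro: cone_step)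

lemma cone_sum: "(\<And>x. x \<in> A \<Longrightarrow> f x \<in> cone n) \<Longrightarrow> sum f A \<in> cone n"
  by (induction A rule: infinite_finite_induct) (auto intro: cone_0 cone_add)

lemma cone_mono: "p \<in> cone n \<Longrightarrow> n \<le> m \<Longrightarrow> p \<in> cone m"
  by (induction rule: cone.induct) (auto intro: cone_0 cone_step)

lemma cone_smult: "p \<in> cone n \<Longrightarrow> a \<ge> 0 \<Longrightarrow> smult a p \<in> cone n"
  by (induction rule: cone.induct) (auto simp: smult_add_right intro: cone_0 cone_step)

lemma cone_mult_generator:
  assumes "p \<in> cone n" "a \<ge> 0" "i \<le> m" "j \<le> m"
  shows "p * smult a ([:0, 1:] ^ j * [:1, 1:] ^ i) \<in> cone (n + m)"
  using assms(1)
proof (induction rule: cone.induct)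
  case (cone_step p b i' j')
  have "(p + smult b ([:0, 1:] ^ j' * [:1, 1:] ^ i')) * smult a ([:0, 1:] ^ j * [:1, 1:] ^ i) =
      p * smult a ([:0, 1:] ^ j * [:1, 1:] ^ i) + smult (b * a) ([:0, 1:] ^ (j' + j) * [:1, 1:] ^ (i' + i))"
    by (simp only: distrib_right) (simp only: power_add mult_smult_left mult_smult_right smult_smult mult_ac)
  then show ?case using cone_step assms by (auto intro!: cone.cone_step)
qed (simp add: cone_0)

lemma cone_mult:
  assumes "p \<in> cone n" "q \<in> cone m"
  shows "p * q \<in> cone (n + m)"
  using assms(2)
proof (induction rule: cone.induct)
  case (cone_step q a i j)
  then show ?case using cone_mult_generator[OF assms(1)] by (simp only: distrib_left cone_add)
qed (simp add: cone_0)

lemma cone_X_power: "j \<le> n \<Longrightarrow> [:0, 1:] ^ j \<in> cone n"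
  using cone_generator[of 1 0 n j] by simp

lemma cone_X: "1 \<le> n \<Longrightarrow> [:0, 1:] \<in> cone n"
  using cone_X_power[of 1 n] by simp

text \<open>Rewriting \<open>X\<^sup>j (1 + X)\<^sup>i = X\<^sup>j (1 + X)\<^bsup>i-1\<^esup> + X\<^bsup>j+1\<^esup> (1 + X)\<^bsup>i-1\<^esup>\<close>
  until \<open>i = 0\<close> or \<open>j = n\<close> leaves only monomials and products with the factor \<open>X\<^sup>n\<close>.\<close>
lemma cone_normal_form:
  assumes "p \<in> cone n"
  shows "\<exists>c k. (\<forall>j. c j \<ge> 0) \<and> (\<forall>i. k i \<ge> 0) \<and>
    p = (\<Sum>j\<le>n. smult (c j) ([:0, 1:] ^ j)) + (\<Sum>i=1..n. smult (k i) ([:0, 1:] ^ n * [:1, 1:] ^ i))"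
    (is "?P p")
proof -
  have add: "?P (p + q)" if pq: "?P p" "?P q" for p q
  proof -
    obtain c k where p: "\<forall>j. c j \<ge> 0" "\<forall>i. k i \<ge> 0"
      "p = (\<Sum>j\<le>n. smult (c j) ([:0, 1:] ^ j)) + (\<Sum>i=1..n. smult (k i) ([:0, 1:] ^ n * [:1, 1:] ^ i))"
      using pq(1) by blast
    obtain c' k' where q: "\<forall>j. c' j \<ge> 0" "\<forall>i. k' i \<ge> 0"
      "q = (\<Sum>j\<le>n. smult (c' j) ([:0, 1:] ^ j)) + (\<Sum>i=1..n. smult (k' i) ([:0, 1:] ^ n * [:1, 1:] ^ i))"
      using pq(2) by blast
    show ?thesis
      by (rule exI[of _ "\<lambda>j. c j + c' j"], rule exI[of _ "\<lambda>i. k i + k' i"])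
        (simp add: p(1,2) q(1,2) p(3) q(3) smult_add_left sum.distrib)
  qed
  have mono: "?P (smult a ([:0, 1:] ^ j))" if "a \<ge> 0" "j \<le> n" for a j
  proof -
    have "(\<Sum>j'\<le>n. smult (if j' = j then a else 0) ([:0, 1:] ^ j')) = (\<Sum>j'\<le>n. if j' = j then smult a ([:0, 1:] ^ j') else 0)"
      by (intro sum.cong) auto
    then show ?thesis using that
      by (intro exI[of _ "\<lambda>j'. if j' = j then a else 0"] exI[of _ "\<lambda>i. 0"]) simp
  qed
  have top: "?P (smult a ([:0, 1:] ^ n * [:1, 1:] ^ i))" if "a \<ge> 0" "1 \<le> i" "i \<le> n" for a i
  proof -
    have "(\<Sum>i'=1..n. smult (if i' = i then a else 0) ([:0, 1:] ^ n * [:1, 1:] ^ i')) =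
        (\<Sum>i'=1..n. if i' = i then smult a ([:0, 1:] ^ n * [:1, 1:] ^ i') else 0)"
      by (intro sum.cong) auto
    then show ?thesis using that
      by (intro exI[of _ "\<lambda>j. 0"] exI[of _ "\<lambda>i'. if i' = i then a else 0"]) simp
  qed
  have gen: "?P (smult a ([:0, 1:] ^ j * [:1, 1:] ^ i))" if a: "a \<ge> 0" and "i \<le> n" "j \<le> n" for a i j
    using that(2,3)
  proof (induction i arbitrary: j)
    case 0
    then show ?case using mono[OF a] by simp
  next
    case (Suc i)
    show ?case
    proof (cases "j = n")
      case True
      then show ?thesis using top[OF a, of "Suc i"] Suc.prems by simp
    next
      case False
      have "[:1, 1:] = 1 + ([:0, 1:] :: real poly)" by (simp add: one_pCons)
      then have "[:1, 1:] ^ Suc i = [:1, 1:] ^ i + [:0, 1:] * ([:1, 1:] :: real poly) ^ i"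
        by (metis distrib_right mult_1 power_Suc)
      then have "[:0, 1:] ^ j * [:1, 1:] ^ Suc i = [:0, 1:] ^ j * [:1, 1:] ^ i + [:0, 1:] ^ Suc j * ([:1, 1:] :: real poly) ^ i"
        by (simp only: distrib_left power_Suc2 mult.assoc)
      then have "smult a ([:0, 1:] ^ j * [:1, 1:] ^ Suc i) =
         smult a ([:0, 1:] ^ j * [:1, 1:] ^ i) + smult a ([:0, 1:] ^ Suc j * [:1, 1:] ^ i)"
        by (simp only: smult_add_right)
      then show ?thesis using add[OF Suc.IH[of j] Suc.IH[of "Suc j"]] Suc.prems False by (simp only:)
    qed
  qed
  show ?thesis using assms
  proof (induction rule: cone.induct)
    case cone_0
    show ?case by (intro exI[of _ "\<lambda>_. 0"]) simp
  next
    case (cone_step p a i j)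
    show ?case by (rule add[OF cone_step.IH gen]) (use cone_step.hyps in auto)
  qed
qed

section \<open>Laurent series that are cone polynomials in \<open>Y\<close>\<close>

definition fls_eval :: "'a::field fls \<Rightarrow> 'a poly \<Rightarrow> 'a fls" where
  "fls_eval Y p = poly (map_poly fls_const p) Y"

lemma fls_eval_pCons [simp]: "fls_eval Y (pCons a p) = fls_const a + Y * fls_eval Y p"
  by (cases "a = 0 \<and> p = 0") (auto simp: fls_eval_def map_poly_pCons)

lemma fls_eval_0 [simp]: "fls_eval Y 0 = 0"
  by (simp add: fls_eval_def)

lemma fls_eval_add: "fls_eval Y (p + q) = fls_eval Y p + fls_eval Y q"
  by (induction p q rule: poly_induct2) (simp_all add: algebra_simps fls_plus_const)

lemma fls_eval_smult: "fls_eval Y (smult a p) = fls_const a * fls_eval Y p"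
  by (induction p) (simp_all add: algebra_simps)

lemma fls_eval_mult: "fls_eval Y (p * q) = fls_eval Y p * fls_eval Y q"
  by (induction p) (simp_all add: algebra_simps fls_eval_add fls_eval_smult)

lemma fls_eval_1 [simp]: "fls_eval Y 1 = 1"
  by (simp add: one_pCons)

lemma fls_eval_power: "fls_eval Y (p ^ n) = fls_eval Y p ^ n"
  by (induction n) (simp_all add: fls_eval_mult)

lemma fls_eval_sum: "fls_eval Y (sum f A) = (\<Sum>x\<in>A. fls_eval Y (f x))"
  by (induction A rule: infinite_finite_induct) (simp_all add: fls_eval_add)

lemma coeff_mult_1: "coeff (p * q :: 'a::comm_semiring_1 poly) 1 = coeff p 0 * coeff q 1 + coeff p 1 * coeff q 0"
  by (simp add: coeff_mult)

text \<open>\<open>J\<close> records powers of \<open>Y\<close> that occur with positive weight, which gives the kernels their exact degrees;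
  \<open>c\<close> and \<open>d\<close> determine the two top kernels.\<close>
definition realises :: "real fls \<Rightarrow> nat \<Rightarrow> nat set \<Rightarrow> real \<Rightarrow> real \<Rightarrow> real fls \<Rightarrow> bool" where
  "realises Y n J c d f \<longleftrightarrow> (\<exists>H e. e > 0 \<and> H - smult e (\<Sum>j\<in>J. [:0, 1:] ^ j) \<in> cone n \<and>
     f = fls_eval Y H \<and> coeff H 0 = c \<and> coeff H 1 = d)"

lemma realises_weaken:
  assumes "realises Y n J c d f" "n \<le> m" "J' \<subseteq> J" "J \<subseteq> {..n}"
  shows "realises Y m J' c d f"
proof -
  obtain H e where H: "e > 0" "H - smult e (\<Sum>j\<in>J. [:0, 1:] ^ j) \<in> cone n"
     "f = fls_eval Y H" "coeff H 0 = c" "coeff H 1 = d"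
    using assms(1) unfolding realises_def by blast
  have "finite J" using assms(4) finite_subset by blast
  then have "(\<Sum>j\<in>J. [:0, 1:] ^ j) = (\<Sum>j\<in>J - J'. [:0, 1:] ^ j) + (\<Sum>j\<in>J'. [:0, 1:] ^ j :: real poly)"
    using assms(3) by (metis sum.subset_diff)
  then have "H - smult e (\<Sum>j\<in>J'. [:0, 1:] ^ j) =
     (H - smult e (\<Sum>j\<in>J. [:0, 1:] ^ j)) + smult e (\<Sum>j\<in>J - J'. [:0, 1:] ^ j)"
    by (simp add: smult_add_right)
  also have "\<dots> \<in> cone n"
    using H assms(4) by (intro cone_add cone_smult cone_sum cone_X_power) auto
  finally have "H - smult e (\<Sum>j\<in>J'. [:0, 1:] ^ j) \<in> cone m" using assms(2) cone_mono by blast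
  then show ?thesis unfolding realises_def using H by blast
qed

lemma realises_add:
  assumes "realises Y n J c d f" "realises Y n J' c' d' g" "J \<subseteq> {..n}" "J' \<subseteq> {..n}" "J \<inter> J' = {}"
  shows "realises Y n (J \<union> J') (c + c') (d + d') (f + g)"
proof -
  obtain H e where H: "e > 0" "H - smult e (\<Sum>j\<in>J. [:0, 1:] ^ j) \<in> cone n"
     "f = fls_eval Y H" "coeff H 0 = c" "coeff H 1 = d"
    using assms(1) unfolding realises_def by blast
  obtain H' e' where H': "e' > 0" "H' - smult e' (\<Sum>j\<in>J'. [:0, 1:] ^ j) \<in> cone n"
     "g = fls_eval Y H'" "coeff H' 0 = c'" "coeff H' 1 = d'"
    using assms(2) unfolding realises_def by blast
  have fin: "finite J" "finite J'" using assms(3,4) finite_subset by blast+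
  let ?e = "min e e'"
  have "(H + H') - smult ?e (\<Sum>j\<in>J \<union> J'. [:0, 1:] ^ j) =
     (H - smult e (\<Sum>j\<in>J. [:0, 1:] ^ j)) + smult (e - ?e) (\<Sum>j\<in>J. [:0, 1:] ^ j) +
     ((H' - smult e' (\<Sum>j\<in>J'. [:0, 1:] ^ j)) + smult (e' - ?e) (\<Sum>j\<in>J'. [:0, 1:] ^ j))"
    using fin assms(5) by (simp add: sum.union_disjoint smult_add_right smult_diff_left)
  also have "\<dots> \<in> cone n"
    using H H' assms(3,4) by (intro cone_add cone_smult cone_sum cone_X_power) auto
  finally show ?thesis unfolding realises_def
    using H H' by (intro exI[of _ "H + H'"] exI[of _ ?e]) (simp add: fls_eval_add)
qed

lemma realises_0: "realises Y n {} 0 0 0"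
  unfolding realises_def by (intro exI[of _ 0] exI[of _ 1]) (simp add: cone_0)

lemma realises_1: "realises Y n {0} 1 0 1"
  unfolding realises_def by (intro exI[of _ 1]) (simp add: cone_0 one_pCons)

lemma realises_sum:
  "(\<And>x. x \<in> A \<Longrightarrow> realises Y n {} (c x) (d x) (f x)) \<Longrightarrow> realises Y n {} (sum c A) (sum d A) (sum f A)"
proof (induction A rule: infinite_finite_induct)
  case (insert x A)
  then show ?case using realises_add[of Y n "{}" "c x" "d x" "f x" "{}" "sum c A" "sum d A" "sum f A"] by simp
qed (simp_all add: realises_0)

lemma realises_smult:
  assumes "realises Y n J c d f" "a > 0"
  shows "realises Y n J (a * c) (a * d) (fls_const a * f)"
proof -
  obtain H e where H: "e > 0" "H - smult e (\<Sum>j\<in>J. [:0, 1:] ^ j) \<in> cone n"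
     "f = fls_eval Y H" "coeff H 0 = c" "coeff H 1 = d"
    using assms(1) unfolding realises_def by blast
  have "smult a H - smult (a * e) (\<Sum>j\<in>J. [:0, 1:] ^ j) = smult a (H - smult e (\<Sum>j\<in>J. [:0, 1:] ^ j))"
    by (simp add: smult_diff_right)
  also have "\<dots> \<in> cone n" using H assms(2) by (intro cone_smult) auto
  finally show ?thesis unfolding realises_def
    using H assms(2) by (intro exI[of _ "smult a H"] exI[of _ "a * e"]) (simp add: fls_eval_smult)
qed

lemma realises_mult_empty:
  assumes "realises Y n {} c d f" "realises Y m {} c' d' g"
  shows "realises Y (n + m) {} (c * c') (c * d' + d * c') (f * g)"
proof -
  obtain H where H: "H \<in> cone n" "f = fls_eval Y H" "coeff H 0 = c" "coeff H 1 = d"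
    using assms(1) unfolding realises_def sum.empty smult_0_right diff_0_right by blast
  obtain H' where H': "H' \<in> cone m" "g = fls_eval Y H'" "coeff H' 0 = c'" "coeff H' 1 = d'"
    using assms(2) unfolding realises_def sum.empty smult_0_right diff_0_right by blast
  show ?thesis unfolding realises_def
    by (rule exI[of _ "H * H'"], rule exI[of _ 1], intro conjI)
      (use H H' cone_mult in \<open>simp_all add: fls_eval_mult coeff_mult_0 coeff_mult_1[simplified]\<close>)
qed

text \<open>If \<open>H\<close> dominates \<open>e S\<close> and \<open>H'\<close> dominates
  \<open>e'\<close>, then \<open>H H' - e e' S = (H - e S) H' + e S (H' - e')\<close>: a positive
  constant term in the second factor preserves \<open>J\<close>.\<close>

lemma realises_mult:
  assumes "realises Y n J c d f" "realises Y m {0} c' d' g" "J \<subseteq> {..n}"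
  shows "realises Y (n + m) J (c * c') (c * d' + d * c') (f * g)"
proof -
  obtain H e where H: "e > 0" "H - smult e (\<Sum>j\<in>J. [:0, 1:] ^ j) \<in> cone n"
     "f = fls_eval Y H" "coeff H 0 = c" "coeff H 1 = d"
    using assms(1) unfolding realises_def by blast
  obtain H' e' where H': "e' > 0" "H' - smult e' 1 \<in> cone m" "g = fls_eval Y H'" "coeff H' 0 = c'" "coeff H' 1 = d'"
    using assms(2) unfolding realises_def by auto
  let ?S = "\<Sum>j\<in>J. [:0, 1:] ^ j :: real poly"
  have "1 \<in> cone m" using cone_X_power[of 0 m] by simp
  then have "(H' - smult e' 1) + smult e' 1 \<in> cone m" using H' by (intro cone_add cone_smult) auto
  then have "H' \<in> cone m" by simp
  moreover have "smult e ?S \<in> cone n" using H assms(3) by (intro cone_smult cone_sum cone_X_power) auto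
  ultimately have "(H - smult e ?S) * H' + smult e ?S * (H' - smult e' 1) \<in> cone (n + m)"
    using H H' by (intro cone_add cone_mult) auto
  also have "(H - smult e ?S) * H' + smult e ?S * (H' - smult e' 1) = H * H' - smult (e * e') ?S"
    by (simp add: left_diff_distrib right_diff_distrib smult_diff_right mult.commute)
  finally show ?thesis unfolding realises_def
    by (intro exI[of _ "H * H'"] exI[of _ "e * e'"])
      (use H H' in \<open>simp add: fls_eval_mult coeff_mult_0 coeff_mult_1[simplified]\<close>)
qed

lemma realises_Y_mult:
  assumes "realises Y n J c d f"
  shows "realises Y (Suc n) (Suc ` J) 0 c (Y * f)"
proof -
  obtain H e where H: "e > 0" "H - smult e (\<Sum>j\<in>J. [:0, 1:] ^ j) \<in> cone n"
     "f = fls_eval Y H" "coeff H 0 = c" "coeff H 1 = d"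
    using assms(1) unfolding realises_def by blast
  let ?S = "\<Sum>j\<in>J. [:0, 1:] ^ j :: real poly"
  have "(\<Sum>j\<in>Suc ` J. [:0, 1:] ^ j) = [:0, 1:] * ?S"
    by (simp only: sum.reindex[OF inj_on_subset[OF inj_Suc subset_UNIV]] o_def power_Suc sum_distrib_left)
  then have "[:0, 1:] * H - smult e (\<Sum>j\<in>Suc ` J. [:0, 1:] ^ j) = (H - smult e ?S) * [:0, 1:]"
    by (simp only: mult_smult_right right_diff_distrib mult.commute)
  also have "\<dots> \<in> cone (n + 1)" using H by (intro cone_mult cone_X) auto
  finally show ?thesis unfolding realises_def
    using H by (intro exI[of _ "[:0, 1:] * H"] exI[of _ e]) simp
qed

text \<open>From \<open>q = 2\<close> on, such a term affects neither the value nor the slope at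
  \<open>Y = 0\<close>, so it has no influence on the two top kernels.\<close>

lemma realises_monomial:
  assumes "2 \<le> q" "p \<le> q"
  shows "realises Y q {} 0 0 (Y ^ q * (1 + Y) ^ p)"
proof -
  obtain r where q: "q = Suc (Suc r)" using assms(1) by (metis Suc_le_D numeral_2_eq_2 Suc_le_mono)
  let ?H = "[:0, 1:] ^ q * [:1, 1:] ^ p :: real poly"
  have "?H \<in> cone q" using cone_generator[of 1 p q q] assms(2) by simp
  moreover have "coeff ?H 0 = 0" "coeff ?H 1 = 0" by (simp_all add: q)
  moreover have "fls_eval Y ?H = Y ^ q * (1 + Y) ^ p"
    by (simp only: fls_eval_mult fls_eval_power) simp
  ultimately show ?thesis unfolding realises_def by (intro exI[of _ ?H] exI[of _ 1]) simp
qed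

text \<open>Truncated at \<open>N\<close> because \<open>\<theta>\<close>, \<open>B\<close> and
  \<open>\<psi>\<close> are treated together, each needing lower coefficients of the others. The
  bound \<open>2 * n\<close> makes the Cauchy product compatible with
  \<open>cone_mult\<close>.\<close>

definition realises_upto ::
  "real fls \<Rightarrow> (nat \<Rightarrow> nat set) \<Rightarrow> nat \<Rightarrow> real fps \<Rightarrow> real fps \<Rightarrow> real fls fps \<Rightarrow> bool" where
  "realises_upto Y J N c d F \<longleftrightarrow> (\<forall>n<N. realises Y (2 * n) (J n) (c $ n) (d $ n) (F $ n))"

lemma realises_upto_Suc:
  "realises_upto Y J (Suc N) c d F \<longleftrightarrow>
     realises_upto Y J N c d F \<and> realises Y (2 * N) (J N) (c $ N) (d $ N) (F $ N)"
  by (auto simp: realises_upto_def less_Suc_eq)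

text \<open>Value and slope obey the product rule. In the Cauchy product only the summand with
  \<open>G $ 0\<close> is used to preserve \<open>J n\<close>; for all others the set is weakened to
  the empty one.\<close>

lemma realises_upto_mult:
  assumes F: "realises_upto Y J N c d F" and G: "realises_upto Y J' N c' d' G"
    and J: "\<And>n. J n \<subseteq> {..2 * n}" "\<And>n. J' n \<subseteq> {..2 * n}" "J' 0 = {0}"
  shows "realises_upto Y J N (c * c') (c * d' + d * c') (F * G)"
  unfolding realises_upto_def
proof (intro allI impI)
  fix n assume n: "n < N"
  have F': "realises Y (2 * i) (J i) (c $ i) (d $ i) (F $ i)" if "i \<le> n" for i
    using F that n by (simp add: realises_upto_def)
  have G': "realises Y (2 * i) (J' i) (c' $ i) (d' $ i) (G $ i)" if "i \<le> n" for i
    using G that n by (simp add: realises_upto_def)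
  have last: "realises Y (2 * n) (J n) (c $ n * c' $ 0) (c $ n * d' $ 0 + d $ n * c' $ 0) (F $ n * G $ 0)"
    using realises_mult[OF F'[of n] G'[of 0, simplified J(3)] J(1)] by simp
  have rest: "realises Y (2 * n) {} (\<Sum>i<n. c $ i * c' $ (n - i)) (\<Sum>i<n. c $ i * d' $ (n - i) + d $ i * c' $ (n - i))
      (\<Sum>i<n. F $ i * G $ (n - i))"
  proof (rule realises_sum)
    fix i assume "i \<in> {..<n}"
    then have i: "i \<le> n" "n - i \<le> n" "2 * i + 2 * (n - i) = 2 * n" by auto
    show "realises Y (2 * n) {} (c $ i * c' $ (n - i)) (c $ i * d' $ (n - i) + d $ i * c' $ (n - i)) (F $ i * G $ (n - i))"
      using realises_mult_empty[OF realises_weaken[OF F'[OF i(1)] order_refl empty_subsetI J(1)]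
          realises_weaken[OF G'[OF i(2)] order_refl empty_subsetI J(2)]] unfolding i(3) .
  qed
  have split: "(\<Sum>i=0..n. h i) = h n + (\<Sum>i<n. h i)" for h :: "nat \<Rightarrow> 'z::comm_monoid_add"
    by (simp add: atLeast0AtMost atMost_Suc lessThan_Suc_atMost[symmetric] add.commute)
  have "realises Y (2 * n) (J n) (\<Sum>i=0..n. c $ i * c' $ (n - i))
      (\<Sum>i=0..n. c $ i * d' $ (n - i) + d $ i * c' $ (n - i)) (\<Sum>i=0..n. F $ i * G $ (n - i))"
    unfolding split using realises_add[OF last rest J(1)] by simp
  then show "realises Y (2 * n) (J n) ((c * c') $ n) ((c * d' + d * c') $ n) ((F * G) $ n)"
    by (simp only: fps_mult_nth fps_add_nth sum.distrib)
qed

definition at_0 :: "nat \<Rightarrow> nat set" where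
  "at_0 n = (if n = 0 then {0} else {})"

lemma realises_upto_1: "realises_upto Y at_0 N 1 0 1"
  by (auto simp: realises_upto_def at_0_def realises_1 realises_0)

lemma realises_upto_power:
  assumes "realises_upto Y at_0 N 1 d F"
  shows "realises_upto Y at_0 N 1 (fps_const (real m) * d) (F ^ m)"
proof (induction m)
  case 0
  then show ?case by (simp add: realises_upto_1)
next
  case (Suc m)
  have "realises_upto Y at_0 N (1 * 1) (1 * (fps_const (real m) * d) + d * 1) (F * F ^ m)"
    by (rule realises_upto_mult[OF assms Suc]) (auto simp: at_0_def)
  moreover have "1 * (fps_const (real m) * d) + d * 1 = fps_const (real (Suc m)) * d"
    by (simp add: distrib_right flip: fps_const_add)
  ultimately show ?case by simp
qed

section \<open>Simultaneous induction on the excess\<close>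

locale real_walk_recursion = walk_recursion b z s c x Y
  for b :: "nat \<Rightarrow> real fls fps" and z s c x Y
begin

text \<open>The slope \<open>X C\<close> is the linear part of
  \<open>\<theta> = 1 + Y X \<psi> \<theta>\<close>, as \<open>\<psi>\<close> has value
  \<open>C\<close> and \<open>\<theta>\<close> has value 1 at \<open>Y = 0\<close>.\<close>

definition \<theta>_upto :: "nat \<Rightarrow> bool" where
  "\<theta>_upto N \<longleftrightarrow> realises_upto Y at_0 N 1 (fps_X * C_fps) \<theta>"
text \<open>Corrections to \<open>B\<close> carry at least \<open>Y^2\<close>, hence value 1 and
  slope 0. The set \<open>{2 * n}\<close> is recorded since \<open>\<psi>\<close> takes its highest
  power of \<open>Y\<close> from \<open>B\<close>.\<close>

definition B_upto :: "nat \<Rightarrow> bool" where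
  "B_upto N \<longleftrightarrow> (\<forall>k. realises_upto Y (\<lambda>n. {2 * n}) N 1 0 (B (Suc k)))"
definition \<psi>_upto :: "nat \<Rightarrow> bool" where
  "\<psi>_upto N \<longleftrightarrow> realises_upto Y (\<lambda>n. {..2 * n}) N C_fps slope_fps \<psi>"

lemma \<theta>_upto_Suc:
  assumes "\<theta>_upto N" "\<psi>_upto N"
  shows "\<theta>_upto (Suc N)"
proof -
  have "realises Y (2 * N) (at_0 N) (1 $ N) ((fps_X * C_fps) $ N) (\<theta> $ N)"
  proof (cases N)
    case 0
    have "\<theta> $ 0 = 1" by (subst \<theta>_eq) simp
    then show ?thesis using 0 by (simp add: at_0_def realises_1)
  next
    case (Suc M)
    have "\<theta> $ Suc M = Y * (\<psi> * \<theta>) $ M" by (subst \<theta>_eq) simp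
    moreover have "realises_upto Y (\<lambda>n. {..2 * n}) N (C_fps * 1) (C_fps * (fps_X * C_fps) + slope_fps * 1) (\<psi> * \<theta>)"
      by (rule realises_upto_mult[where J' = at_0]) (use assms in \<open>auto simp: at_0_def \<theta>_upto_def \<psi>_upto_def\<close>)
    then have "realises Y (2 * M) {..2 * M} (C_fps $ M) ((C_fps * (fps_X * C_fps) + slope_fps) $ M) ((\<psi> * \<theta>) $ M)"
      using Suc by (simp add: realises_upto_def)
    from realises_weaken[OF realises_Y_mult[OF this], of "2 * N" "{}"]
    have "realises Y (2 * N) {} 0 (C_fps $ M) (Y * (\<psi> * \<theta>) $ M)" using Suc by auto
    ultimately show ?thesis using Suc by (simp add: at_0_def)
  qed
  then show ?thesis using assms by (simp add: \<theta>_upto_def realises_upto_Suc)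
qed

lemma product_realised:
  assumes "\<theta>_upto N" "B_upto N" "k \<ge> 1" "l \<ge> 1"
  shows "realises_upto Y (\<lambda>n. {2 * n}) N 1 (fps_const (real m) * (fps_X * C_fps)) (\<theta> ^ m * (B k * B l))"
proof -
  have B: "realises_upto Y (\<lambda>n. {2 * n}) N 1 0 (B k)" if "k \<ge> 1" for k
    using assms(2) that unfolding B_upto_def by (metis Suc_pred' less_eq_Suc_le One_nat_def)
  have "realises_upto Y (\<lambda>n. {2 * n}) N (1 * 1) (1 * 0 + 0 * 1) (B k * B l)"
    by (rule realises_upto_mult[where J' = "\<lambda>n. {2 * n}"]) (use B assms in auto)
  then have BB: "realises_upto Y (\<lambda>n. {2 * n}) N 1 0 (B k * B l)" by simp
  have "realises_upto Y (\<lambda>n. {2 * n}) N (1 * 1) (1 * (fps_const (real m) * (fps_X * C_fps)) + 0 * 1) ((B k * B l) * \<theta> ^ m)"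
    by (rule realises_upto_mult[OF BB realises_upto_power])
      (use assms(1) in \<open>auto simp: \<theta>_upto_def at_0_def\<close>)
  then show ?thesis by (simp add: mult.commute)
qed

lemma monomial_product_realised:
  assumes "\<theta>_upto N" "B_upto N" "k \<ge> 1" "l \<ge> 1" "n < N" "2 \<le> q" "p \<le> q" "a > 0"
  shows "realises Y (2 * n + q) {} 0 0 (fls_const a * (Y ^ q * (1 + Y) ^ p) * (\<theta> ^ m * (B k * B l)) $ n)"
proof -
  let ?T = "\<theta> ^ m * (B k * B l)"
  have "realises Y (2 * n) {2 * n} (1 $ n) ((fps_const (real m) * (fps_X * C_fps)) $ n) (?T $ n)"
    using product_realised[OF assms(1-4)] assms(5) by (simp only: realises_upto_def)
  then have "realises Y (2 * n) {} (1 $ n) ((fps_const (real m) * (fps_X * C_fps)) $ n) (?T $ n)"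
    by (rule realises_weaken) auto
  from realises_smult[OF realises_mult_empty[OF realises_monomial[OF assms(6,7), of Y] this] assms(8)]
  show ?thesis by (simp add: mult.assoc add.commute)
qed

text \<open>The summand \<open>p = 0\<close> is \<open>Y^2\<close> times a product with top power
  \<open>Y^(2 M)\<close>, and so supplies \<open>Y^(2 N)\<close> for \<open>N = M + 1\<close>. The
  summands with \<open>p \<ge> 1\<close> only have to stay in the cone.\<close>

lemma B_upto_Suc:
  assumes "\<theta>_upto N" "B_upto N"
  shows "B_upto (Suc N)"
proof -
  have "realises Y (2 * N) {2 * N} (1 $ N) (0 $ N) (B (Suc k) $ N)" for k
  proof (cases N)
    case 0
    have "B k $ 0 = 1" for k
    proof (induction k)
      case (Suc k)
      then show ?case by (subst B_Suc) simp
    qed (simp add: B_0)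
    then show ?thesis using 0 by (simp add: realises_1)
  next
    case (Suc M)
    define T where "T k p = \<theta> ^ (2 * p + 4) * (B (k + p + 2) * B (p + 2))" for k p
    define S where "S k p = fls_const (real ((k + Suc p) choose k)) * (Y ^ (2 * p + 2) * (1 + Y) ^ p) * T k p $ (M - p)" for k p
    have pos: "real ((k + Suc p) choose k) > 0" for k p by simp
    have step: "B (Suc k) $ N = B k $ N + (S k 0 + (\<Sum>p=1..M. S k p))" for k
    proof -
      have "B (Suc k) $ N = B k $ N + (\<Sum>p\<le>M. S k p)"
        by (subst B_Suc) (simp add: Suc fps_series_nth S_def T_def fls_of_nat)
      also have "(\<Sum>p\<le>M. S k p) = S k 0 + (\<Sum>p=1..M. S k p)"
        by (simp add: sum.atLeast_Suc_atMost flip: atLeast0AtMost)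
      finally show ?thesis .
    qed
    have S0: "realises Y (2 * N) {2 * N} 0 0 (S k 0)" for k
    proof -
      have "realises_upto Y (\<lambda>n. {2 * n}) N 1 (fps_const (real (2 * 0 + 4)) * (fps_X * C_fps)) (T k 0)"
        unfolding T_def by (rule product_realised[OF assms]) auto
      then have "realises Y (2 * M) {2 * M} (1 $ M) ((fps_const (real (2 * 0 + 4)) * (fps_X * C_fps)) $ M) (T k 0 $ M)"
        unfolding realises_upto_def using Suc lessI by blast
      from realises_smult[OF realises_Y_mult[OF realises_Y_mult[OF this]] pos[of k 0]]
      show ?thesis by (simp add: S_def Suc power2_eq_square mult.assoc)
    qed
    have Sp: "realises Y (2 * N) {} 0 0 (\<Sum>p=1..M. S k p)" for k
    proof -
      have "realises Y (2 * N) {} (\<Sum>p=1..M. 0) (\<Sum>p=1..M. 0) (\<Sum>p=1..M. S k p)"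
      proof (rule realises_sum)
        fix p assume p: "p \<in> {1..M}"
        then have e: "2 * (M - p) + (2 * p + 2) = 2 * N" using Suc by auto
        have "realises Y (2 * (M - p) + (2 * p + 2)) {} 0 0 (S k p)"
          unfolding S_def T_def using p Suc by (intro monomial_product_realised[OF assms] pos) auto
        then show "realises Y (2 * N) {} 0 0 (S k p)" unfolding e .
      qed
      then show ?thesis by simp
    qed
    have SS: "realises Y (2 * N) {2 * N} 0 0 (S k 0 + (\<Sum>p=1..M. S k p))" for k
      using realises_add[OF S0 Sp] by simp
    show ?thesis
    proof (induction k)
      case 0
      have "B 0 $ N = 0" by (simp add: B_0 Suc)
      then show ?case using SS[of 0] unfolding step[of 0] by (simp add: Suc)
    next
      case (Suc k)
      \<comment> \<open>The set \<open>{2 * N}\<close> is given up here because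
        \<open>realises_add\<close> asks for disjoint sets and the increment supplies it
        again.\<close>
      have "realises Y (2 * N) {} (1 $ N) (0 $ N) (B (Suc k) $ N)"
        by (rule realises_weaken[OF Suc]) auto
      from realises_add[OF this SS[of "Suc k"]] show ?case unfolding step[of "Suc k"] by simp
    qed
  qed
  then show ?thesis using assms by (simp add: B_upto_def realises_upto_Suc)
qed

text \<open>For \<open>N = M + 1\<close>, the term \<open>(1 + Y) \<psi>^2\<close> yields the powers
  of \<open>Y\<close> up to \<open>2 M + 1\<close>; the missing power \<open>2 N\<close> comes from
  the summand \<open>p = 0\<close>, whose factor \<open>\<theta>^4\<close> also gives the term
  \<open>4 X C\<close> of \<open>slope_fps_eq\<close>.\<close>

lemma \<psi>_upto_Suc:
  assumes "\<theta>_upto (Suc N)" "B_upto (Suc N)" "\<psi>_upto N"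
  shows "\<psi>_upto (Suc N)"
proof -
  define T where "T p = \<theta> ^ (2 * p + 4) * (B (p + 2) * B (p + 2))" for p
  define S where "S p = fls_const 1 * (Y ^ (2 * p) * (1 + Y) ^ p) * T p $ (N - p)" for p
  have step: "\<psi> $ N = (fps_const (1 + Y) * (fps_X * \<psi>\<^sup>2)) $ N + (S 0 + (\<Sum>p=1..N. S p))"
  proof -
    have "\<psi> $ N = (fps_const (1 + Y) * (fps_X * \<psi>\<^sup>2)) $ N + (\<Sum>p\<le>N. S p)"
      by (subst \<psi>_eq) (simp add: fps_series_nth S_def T_def power2_eq_square)
    also have "(\<Sum>p\<le>N. S p) = S 0 + (\<Sum>p=1..N. S p)"
      by (simp add: sum.atLeast_Suc_atMost flip: atLeast0AtMost)
    finally show ?thesis .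
  qed
  have S0: "realises Y (2 * N) {2 * N} (1 $ N) ((fps_const 4 * (fps_X * C_fps)) $ N) (S 0)"
  proof -
    have "realises_upto Y (\<lambda>n. {2 * n}) (Suc N) 1 (fps_const (real (2 * 0 + 4)) * (fps_X * C_fps)) (T 0)"
      unfolding T_def by (rule product_realised[OF assms(1,2)]) auto
    then have "realises Y (2 * N) {2 * N} (1 $ N) ((fps_const (real (2 * 0 + 4)) * (fps_X * C_fps)) $ N) (T 0 $ N)"
      unfolding realises_upto_def using lessI by blast
    then show ?thesis by (simp add: S_def)
  qed
  have "realises Y (2 * N) {} (\<Sum>p=1..N. 0) (\<Sum>p=1..N. 0) (\<Sum>p=1..N. S p)"
  proof (rule realises_sum)
    fix p assume p: "p \<in> {1..N}"
    then have e: "2 * (N - p) + 2 * p = 2 * N" by auto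
    have "realises Y (2 * (N - p) + 2 * p) {} 0 0 (S p)"
      unfolding S_def T_def using p by (intro monomial_product_realised[OF assms(1,2)]) auto
    then show "realises Y (2 * N) {} 0 0 (S p)" unfolding e .
  qed
  then have Sp: "realises Y (2 * N) {} 0 0 (\<Sum>p=1..N. S p)" by simp
  have SS: "realises Y (2 * N) {2 * N} (1 $ N) ((fps_const 4 * (fps_X * C_fps)) $ N) (S 0 + (\<Sum>p=1..N. S p))"
    using realises_add[OF S0 Sp] by simp
  have "realises Y (2 * N) {..2 * N} (C_fps $ N) (slope_fps $ N) (\<psi> $ N)"
  proof (cases N)
    case 0
    have "C_fps $ 0 = 1" "slope_fps $ 0 = 0" by (simp_all add: C_fps_def slope_fps_nth)
    moreover have "{..0::nat} = {0}" by auto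
    moreover have "(fps_const (1 + Y) * (fps_X * \<psi>\<^sup>2)) $ 0 = 0" by simp
    ultimately show ?thesis using SS unfolding step by (simp add: 0)
  next
    case (Suc M)
    define c' where "c' = (C_fps * C_fps) $ M"
    define d' where "d' = (C_fps * slope_fps + slope_fps * C_fps) $ M"
    define f where "f = (\<psi> * \<psi>) $ M"
    have "realises_upto Y (\<lambda>n. {..2 * n}) N (C_fps * C_fps) (C_fps * slope_fps + slope_fps * C_fps) (\<psi> * \<psi>)"
      by (rule realises_upto_mult[where J' = "\<lambda>n. {..2 * n}"]) (use assms(3) in \<open>auto simp: \<psi>_upto_def\<close>)
    then have f: "realises Y (2 * M) {..2 * M} c' d' f"
      using Suc by (simp add: realises_upto_def c'_def d'_def f_def)
    have 1: "realises Y (2 * N) {..2 * M} c' d' f"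
      by (rule realises_weaken[OF f]) (use Suc in auto)
    have 2: "realises Y (2 * N) {Suc (2 * M)} 0 c' (Y * f)"
      by (rule realises_weaken[OF realises_Y_mult[OF f]]) (use Suc in auto)
    have 3: "realises Y (2 * N) ({..2 * M} \<union> {Suc (2 * M)}) (c' + 0) (d' + c') (f + Y * f)"
      by (rule realises_add[OF 1 2]) (use Suc in auto)
    have "realises Y (2 * N) ({..2 * M} \<union> {Suc (2 * M)} \<union> {2 * N}) (c' + 0 + 1 $ N)
       (d' + c' + (fps_const 4 * (fps_X * C_fps)) $ N) (f + Y * f + (S 0 + (\<Sum>p=1..N. S p)))"
      by (rule realises_add[OF 3 SS]) (use Suc in auto)
    moreover have "{..2 * M} \<union> {Suc (2 * M)} \<union> {2 * N} = {..2 * N}" using Suc by auto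
    moreover have "c' + 0 + 1 $ N = C_fps $ N"
      by (subst C_fps_eq) (simp add: Suc c'_def power2_eq_square)
    moreover have "d' + c' + (fps_const 4 * (fps_X * C_fps)) $ N = slope_fps $ N"
    proof -
      have "slope_fps $ N = (fps_const 2 * C_fps * slope_fps + C_fps\<^sup>2) $ M + (fps_const 4 * (fps_X * C_fps)) $ N"
        by (subst slope_fps_eq) (simp add: Suc)
      also have "fps_const 2 * C_fps * slope_fps = C_fps * slope_fps + slope_fps * C_fps"
        by (simp add: algebra_simps flip: fps_numeral_fps_const)
      also have "(C_fps * slope_fps + slope_fps * C_fps + C_fps\<^sup>2) $ M = d' + c'"
        by (simp add: d'_def c'_def power2_eq_square)
      finally show ?thesis by simp
    qed
    moreover have "f + Y * f + (S 0 + (\<Sum>p=1..N. S p)) = \<psi> $ N"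
      unfolding step by (simp add: Suc f_def power2_eq_square distrib_right)
    ultimately show ?thesis by simp
  qed
  then show ?thesis using assms by (simp add: \<psi>_upto_def realises_upto_Suc)
qed

lemma \<psi>_realised: "realises Y (2 * n) {..2 * n} (C_fps $ n) (slope_fps $ n) (\<psi> $ n)"
proof -
  have "\<theta>_upto N \<and> B_upto N \<and> \<psi>_upto N" for N
  proof (induction N)
    case 0
    show ?case by (simp add: \<theta>_upto_def B_upto_def \<psi>_upto_def realises_upto_def)
  next
    case (Suc N)
    then show ?case using \<theta>_upto_Suc B_upto_Suc \<psi>_upto_Suc by blast
  qed
  then have "\<psi>_upto (Suc n)" by blast
  then show ?thesis by (simp add: \<psi>_upto_def realises_upto_def)
qed

end

section \<open>Kernels\<close>

text \<open>The normal form is applied after \<open>e\<close> has been subtracted from every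
  monomial coefficient; adding it back makes all \<open>c j\<close> strictly positive.\<close>

lemma realises_expansion:
  assumes "realises Y n {..n} a d f"
  shows "\<exists>c k. (\<forall>j. c j > 0) \<and> (\<forall>i. k i \<ge> 0) \<and> c 0 = a \<and> (n \<ge> 2 \<longrightarrow> c 1 = d) \<and>
    f = (\<Sum>j\<le>n. fls_const (c j) * Y ^ j) + (\<Sum>i=1..n. fls_const (k i) * (Y ^ n * (1 + Y) ^ i))"
proof -
  obtain H e where H: "e > 0" "H - smult e (\<Sum>j\<le>n. [:0, 1:] ^ j) \<in> cone n"
     "f = fls_eval Y H" "coeff H 0 = a" "coeff H 1 = d"
    using assms unfolding realises_def by blast
  obtain c k where ck: "\<And>j. c j \<ge> 0" "\<And>i. k i \<ge> 0"
    "H - smult e (\<Sum>j\<le>n. [:0, 1:] ^ j) =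
      (\<Sum>j\<le>n. smult (c j) ([:0, 1:] ^ j)) + (\<Sum>i=1..n. smult (k i) ([:0, 1:] ^ n * [:1, 1:] ^ i))"
    using cone_normal_form[OF H(2)] by blast
  have H_eq: "H = (\<Sum>j\<le>n. smult (c j + e) ([:0, 1:] ^ j)) + (\<Sum>i=1..n. smult (k i) ([:0, 1:] ^ n * [:1, 1:] ^ i))"
  proof -
    have "smult e (\<Sum>j\<le>n. [:0, 1:] ^ j) = (\<Sum>j\<le>n. smult e ([:0, 1:] ^ j))"
      by (induction n) (simp_all add: smult_add_right)
    then have "H = (\<Sum>j\<le>n. smult (c j) ([:0, 1:] ^ j)) + (\<Sum>j\<le>n. smult e ([:0, 1:] ^ j)) +
        (\<Sum>i=1..n. smult (k i) ([:0, 1:] ^ n * [:1, 1:] ^ i))"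
      using ck(3) by (simp add: algebra_simps)
    then show ?thesis by (simp only: smult_add_left sum.distrib)
  qed
  have H_monom: "H = (\<Sum>j\<le>n. monom (c j + e) j) + (\<Sum>i=1..n. smult (k i) (monom 1 n * [:1, 1:] ^ i))"
    unfolding H_eq monom_altdef smult_1_left ..
  \<comment> \<open>The mixed terms are divisible by \<open>X^n\<close>, and for
    \<open>n = 0\<close> their sum is empty.\<close>
  have low: "coeff H j = c j + e" if "j < n \<or> n = 0 \<and> j = 0" for j
  proof -
    have "(\<Sum>i=1..n. k i * coeff (monom 1 n * [:1, 1:] ^ i) j) = 0"
      using that by (auto simp: coeff_monom_mult)
    moreover have "(\<Sum>j'\<le>n. coeff (monom (c j' + e) j') j) = (\<Sum>j'\<le>n. if j' = j then c j' + e else 0)"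
      by (intro sum.cong) auto
    moreover have "j \<le> n" using that by auto
    ultimately show ?thesis unfolding H_monom by (simp add: coeff_sum)
  qed
  have f: "f = (\<Sum>j\<le>n. fls_const (c j + e) * Y ^ j) + (\<Sum>i=1..n. fls_const (k i) * (Y ^ n * (1 + Y) ^ i))"
    unfolding H(3) by (subst H_eq) (simp add: fls_eval_add fls_eval_sum fls_eval_smult fls_eval_mult fls_eval_power)
  have pos: "c j + e > 0" for j using ck(1)[of j] H(1) by simp
  have "c 0 + e = a" using low[of 0] H(4) by (cases "n = 0") auto
  moreover have "n \<ge> 2 \<longrightarrow> c 1 + e = d" using low[of 1] H(5) by auto
  ultimately show ?thesis using f pos ck(2) by (intro exI[of _ "\<lambda>j. c j + e"] exI[of _ k]) simp
qed

section \<open>Passage between power series and Laurent series\<close>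

lemma fps_to_fls_mult: "fps_to_fls (f * g) = fps_to_fls f * fps_to_fls (g :: 'a::comm_ring_1 fps)"
  by (simp add: fls_times_fps_to_fls)

lemma fps_to_fls_sum: "fps_to_fls (sum f A) = (\<Sum>x\<in>A. fps_to_fls (f x))"
  by (induction A rule: infinite_finite_induct) simp_all

lemma fps_to_fls_inverse:
  fixes f :: "'a::field fps"
  assumes "f $ 0 \<noteq> 0"
  shows "fps_to_fls (inverse f) = inverse (fps_to_fls f)"
proof -
  have "fps_to_fls (f * inverse f) = 1" using inverse_mult_eq_1'[OF assms] by simp
  then show ?thesis by (simp add: fps_to_fls_mult inverse_unique)
qed

lemma fps_to_fls_poly_at_fps: "fps_to_fls (poly_at_fps p f) = fls_eval (fps_to_fls f) p"
proof (induction p)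
  case (pCons a p)
  have "poly_at_fps (pCons a p) f = fps_const a + f * poly_at_fps p f"
    using pCons.hyps by (simp add: poly_at_fps_def map_poly_pCons)
  then show ?case using pCons.IH by (simp add: fps_to_fls_mult)
qed (simp add: poly_at_fps_def)

lemma fls_eval_monom: "fls_eval Y (monom a m) = fls_const a * Y ^ m"
  by (simp add: monom_altdef fls_eval_smult fls_eval_power)

lemma W_fps_0: "W_fps 0 = C_fps"
proof (rule C_fps_unique)
  show "W_fps 0 = 1 + fps_X * (W_fps 0)\<^sup>2"
    using walk_fps_Suc[of 0 0] by (simp add: W_fps_eq walk_fps_0 power2_eq_square)
qed

definition x_fls :: "real fls" where
  "x_fls = fps_to_fls (fps_X * C_fps\<^sup>2)"

definition Y_fls :: "real fls" where
  "Y_fls = (1 - x_fls) / x_fls"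

lemma C_fps_nth_0: "C_fps $ 0 = 1"
  by (simp add: C_fps_def)

lemma x_fls_neq: "x_fls \<noteq> 0" "x_fls \<noteq> 1"
proof -
  have "C_fps \<noteq> 0" using C_fps_nth_0 by (metis fps_zero_nth zero_neq_one)
  then show "x_fls \<noteq> 0" by (simp add: x_fls_def)
  have "(fps_X * C_fps\<^sup>2) $ 0 \<noteq> 1 $ 0" by simp
  then have "fps_X * C_fps\<^sup>2 \<noteq> 1" by metis
  then show "x_fls \<noteq> 1" by (simp add: x_fls_def)
qed

text \<open>Here the abstract recursion is applied to the walk series with excess
  \<open>\<xi>\<close> weighted by \<open>s^\<xi>\<close>; undoing this weight and the factor
  \<open>Y / x\<close> between \<open>\<omega>\<close> and \<open>\<psi>\<close> yields the
  prefactor.\<close>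

lemma W_fps_realised:
  assumes "\<xi> \<ge> 1"
  shows "\<exists>f. realises Y_fls (2 * (\<xi> - 1)) {..2 * (\<xi> - 1)} (C_fps $ (\<xi> - 1)) (slope_fps $ (\<xi> - 1)) f \<and>
     fps_to_fls (W_fps \<xi>) = fps_to_fls C_fps * (Y_fls / x_fls * (x_fls\<^sup>2 / Y_fls\<^sup>2) ^ \<xi> * f)"
proof -
  define c where "c = fps_to_fls C_fps"
  define s where "s = Y_fls\<^sup>2 / x_fls\<^sup>2"
  define b where "b k = Abs_fps (\<lambda>\<xi>. fps_to_fls (walk_fps k \<xi>) * s ^ \<xi>)" for k
  have c0: "c \<noteq> 0" using C_fps_nth_0 by (auto simp: c_def)
  interpret real_walk_recursion b fls_X s c x_fls Y_fls
  proof
    show "b 0 = 1" by (rule fps_ext) (simp add: b_def walk_fps_0)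
    show "c = 1 + fls_X * c\<^sup>2"
      unfolding c_def by (subst C_fps_eq) (simp add: fps_to_fls_mult fps_to_fls_power)
    show "b 1 $ 0 = c" using W_fps_0 by (simp add: b_def W_fps_eq c_def)
    show "x_fls = fls_X * c\<^sup>2" by (simp add: x_fls_def c_def fps_to_fls_mult fps_to_fls_power)
    show "c \<noteq> 0" "x_fls \<noteq> 0" "x_fls \<noteq> 1" using c0 x_fls_neq by auto
    show "Y_fls = (1 - x_fls) / x_fls" by (rule Y_fls_def)
    show "s = Y_fls\<^sup>2 / x_fls\<^sup>2" by (rule s_def)
    fix k
    show "b (Suc k) = b k + fps_series (\<lambda>p.
       fps_const (of_nat ((k + p) choose k) * fls_X ^ Suc p * s ^ p) * (b (k + Suc p) * b (Suc p)))"
    proof (rule fps_ext)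
      fix n
      define t where "t p = fps_to_fls (fps_const (real ((k + p) choose k)) * (fps_X ^ Suc p *
         (\<Sum>i\<le>n - p. walk_fps (k + Suc p) i * walk_fps (Suc p) (n - p - i))))" for p
      have "(fps_const (of_nat ((k + p) choose k) * fls_X ^ Suc p * s ^ p) * (b (k + Suc p) * b (Suc p))) $ (n - p) =
          t p * s ^ n" if p: "p \<le> n" for p
      proof -
        have "(b (k + Suc p) * b (Suc p)) $ (n - p) =
            (\<Sum>i\<le>n - p. fps_to_fls (walk_fps (k + Suc p) i * walk_fps (Suc p) (n - p - i)) * s ^ (n - p))"
          unfolding fps_mult_nth atLeast0AtMost
        proof (rule sum.cong[OF refl])
          fix i assume "i \<in> {..n - p}"
          then have "i + (n - p - i) = n - p" by simp
          then have "s ^ (n - p) = s ^ i * s ^ (n - p - i)" by (simp only: power_add[symmetric])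
          then show "b (k + Suc p) $ i * b (Suc p) $ (n - p - i) =
             fps_to_fls (walk_fps (k + Suc p) i * walk_fps (Suc p) (n - p - i)) * s ^ (n - p)"
            by (simp add: b_def fps_to_fls_mult)
        qed
        also have "\<dots> = fps_to_fls (\<Sum>i\<le>n - p. walk_fps (k + Suc p) i * walk_fps (Suc p) (n - p - i)) * s ^ (n - p)"
          by (simp only: fps_to_fls_sum sum_distrib_right)
        finally have e: "(b (k + Suc p) * b (Suc p)) $ (n - p) = \<dots>" .
        have "p + (n - p) = n" using p by simp
        then have "s ^ n = s ^ p * s ^ (n - p)" by (simp only: power_add[symmetric])
        then show ?thesis
          unfolding fps_mult_left_const_nth e t_def fps_to_fls_mult fps_const_to_fls fps_to_fls_power fps_X_to_fls fls_of_nat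
          by (simp only: mult_ac)
      qed
      then have "fps_series (\<lambda>p. fps_const (of_nat ((k + p) choose k) * fls_X ^ Suc p * s ^ p) * (b (k + Suc p) * b (Suc p))) $ n =
          (\<Sum>p\<le>n. t p * s ^ n)"
        unfolding fps_series_nth by (intro sum.cong) auto
      moreover have "b (Suc k) $ n = b k $ n + (\<Sum>p\<le>n. t p * s ^ n)"
        unfolding b_def fps_nth_Abs_fps
        by (subst walk_fps_Suc) (simp only: fps_to_fls_plus fps_to_fls_sum t_def distrib_right sum_distrib_right)
      ultimately show "b (Suc k) $ n = (b k + fps_series (\<lambda>p.
          fps_const (of_nat ((k + p) choose k) * fls_X ^ Suc p * s ^ p) * (b (k + Suc p) * b (Suc p)))) $ n"
        by simp
    qed
  qed
  obtain m where m: "\<xi> = Suc m" using assms by (cases \<xi>) auto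
  have "\<omega> $ \<xi> = fps_to_fls (W_fps \<xi>) * s ^ \<xi> / c"
    by (simp add: \<omega>_def b_def m W_fps_eq)
  moreover have "\<omega> $ \<xi> = Y_fls / x_fls * \<psi> $ m"
    unfolding \<omega>_eq by (simp add: m)
  ultimately have "fps_to_fls (W_fps \<xi>) * s ^ \<xi> / c = Y_fls / x_fls * \<psi> $ m" by (simp only:)
  then have "fps_to_fls (W_fps \<xi>) * s ^ \<xi> = c * (Y_fls / x_fls * \<psi> $ m)"
    using c0 by (metis nonzero_divide_eq_eq mult.commute)
  moreover have "s * (x_fls\<^sup>2 / Y_fls\<^sup>2) = 1"
    using Y_nonzero x_fls_neq by (simp add: s_def)
  then have "s ^ \<xi> * (x_fls\<^sup>2 / Y_fls\<^sup>2) ^ \<xi> = 1"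
    by (simp only: power_mult_distrib[symmetric] power_one)
  ultimately have "fps_to_fls (W_fps \<xi>) = c * (Y_fls / x_fls * (x_fls\<^sup>2 / Y_fls\<^sup>2) ^ \<xi> * \<psi> $ m)"
    by (metis (no_types, lifting) mult.assoc mult.commute mult.right_neutral)
  then show ?thesis using \<psi>_realised[of m] m by (auto simp: c_def)
qed

text \<open>The left side is \<open>x^(2 m + 1) / Y^(r + 1)\<close> with \<open>r = 2 m - j\<close>,
  and each \<open>1 / Y\<close> is \<open>x / (1 - x)\<close>.\<close>

lemma expansion_term:
  fixes x Y :: "'a::field"
  assumes "x \<noteq> 0" "x \<noteq> 1" "Y = (1 - x) / x" "j \<le> 2 * m"
  shows "Y / x * (x\<^sup>2 / Y\<^sup>2) ^ Suc m * Y ^ j = x ^ (2 * Suc m + (2 * m - j)) / (1 - x) ^ (2 * m - j + 1)"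
proof -
  define r where "r = 2 * m - j"
  have Y: "Y \<noteq> 0" "Y * x = 1 - x" using assms by auto
  have e: "2 * Suc m = r + 1 + (j + 1)" "2 * Suc m + r = (2 * m + 1) + (r + 1)" using assms(4) by (auto simp: r_def)
  have "(x\<^sup>2 / Y\<^sup>2) ^ Suc m = x ^ (2 * Suc m) / Y ^ (2 * Suc m)"
    by (simp only: power_divide power_mult)
  also have "x ^ (2 * Suc m) = x ^ (2 * m + 1) * x" by simp
  also have "Y ^ (2 * Suc m) = Y ^ (r + 1) * (Y ^ j * Y)" unfolding e(1) by (simp only: power_add power_one_right)
  finally have "Y / x * (x\<^sup>2 / Y\<^sup>2) ^ Suc m * Y ^ j = x ^ (2 * m + 1) / Y ^ (r + 1)"
    using assms(1) Y by (simp add: field_simps)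
  also have "\<dots> = x ^ (2 * m + 1) * x ^ (r + 1) / (Y * x) ^ (r + 1)"
    using assms(1) by (simp add: power_mult_distrib)
  also have "x ^ (2 * m + 1) * x ^ (r + 1) = x ^ (2 * Suc m + r)" unfolding e(2) by (simp only: power_add)
  finally show ?thesis unfolding Y(2) r_def .
qed

lemma sum_atMost_reverse: "(\<Sum>j\<le>n. g j) = (\<Sum>s\<le>n. g (n - s :: nat))"
  by (rule sum.reindex_bij_witness[where i = "\<lambda>s. n - s" and j = "\<lambda>j. n - j"]) auto

lemma W_fps_kernels:
  assumes "\<xi> \<ge> 1"
  shows "\<exists>K :: nat \<Rightarrow> real poly.
         (\<forall>s \<le> 2 * \<xi> - 2. (\<forall>i. coeff (K s) i \<ge> 0) \<and> degree (K s) = 2 * \<xi> + s) \<and>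
         W_fps \<xi> = C_fps * (\<Sum>s \<le> 2 * \<xi> - 2.
             poly_at_fps (K s) (fps_X * C_fps ^ 2)
             * inverse ((1 - fps_X * C_fps ^ 2) ^ (s + 1))) \<and>
         K (2 * \<xi> - 2) = monom (Cat (\<xi> - 1)) (4 * \<xi> - 2) \<and>
         (\<xi> \<ge> 2 \<longrightarrow> K (2 * \<xi> - 3) = monom (real (3 * \<xi> - 1) * Cat (\<xi> - 1)) (4 * \<xi> - 3))"
proof -
  obtain m where \<xi>: "\<xi> = Suc m" using assms by (cases \<xi>) auto
  define n where "n = 2 * m"
  let ?x = x_fls and ?Y = Y_fls
  obtain f where f: "realises ?Y n {..n} (C_fps $ m) (slope_fps $ m) f"
    "fps_to_fls (W_fps \<xi>) = fps_to_fls C_fps * (?Y / ?x * (?x\<^sup>2 / ?Y\<^sup>2) ^ \<xi> * f)"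
    using W_fps_realised[OF assms] by (auto simp: \<xi> n_def)
  obtain c k where ck: "\<And>j. c j > 0" "\<And>i. k i \<ge> 0" "c 0 = C_fps $ m" "n \<ge> 2 \<longrightarrow> c 1 = slope_fps $ m"
    and f_eq: "f = (\<Sum>j\<le>n. fls_const (c j) * ?Y ^ j) + (\<Sum>i=1..n. fls_const (k i) * (?Y ^ n * (1 + ?Y) ^ i))"
    using realises_expansion[OF f(1)] by blast
  \<comment> \<open>Since \<open>1 + Y = 1 / x\<close>, a mixed term contributes
    \<open>x^(2 \<xi> - i) / (1 - x)\<close>. As \<open>i\<close> is at least 1 and at most
    \<open>2 \<xi> - 2\<close>, this is a polynomial numerator of degree below
    \<open>2 \<xi>\<close>, so the degree of \<open>K 0\<close> is unaffected.\<close>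
  define R where "R = (\<Sum>i=1..n. monom (k i) (2 * \<xi> - i))"
  define K where "K s = monom (c (n - s)) (2 * \<xi> + s) + (if s = 0 then R else 0)" for s
  have degR: "degree R < 2 * \<xi>"
    unfolding R_def
  proof (rule degree_sum_less)
    fix i assume "i \<in> {1..n}"
    then show "degree (monom (k i) (2 * \<xi> - i)) < 2 * \<xi>"
      using degree_monom_le[of "k i" "2 * \<xi> - i"] by (auto simp: \<xi>)
  qed (simp add: \<xi>)
  have nonneg: "coeff (K s) i \<ge> 0" for s i
    using ck(1)[THEN less_imp_le] ck(2) by (auto simp: K_def R_def coeff_sum intro!: add_nonneg_nonneg sum_nonneg)
  have degree: "degree (K s) = 2 * \<xi> + s" for s
  proof -
    have "degree (monom (c (n - s)) (2 * \<xi> + s)) = 2 * \<xi> + s"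
      using ck(1)[of "n - s"] by (intro degree_monom_eq) simp
    then show ?thesis using degR by (auto simp: K_def degree_add_eq_left)
  qed
  have lead: "K (2 * \<xi> - 2) = monom (Cat (\<xi> - 1)) (4 * \<xi> - 2)"
  proof -
    \<comment> \<open>For \<open>\<xi> = 1\<close> the top kernel is also the kernel with
      \<open>s = 0\<close>, the only one that receives \<open>R\<close>.\<close>
    have "R = 0" if "n = 0" using that by (simp add: R_def)
    then show ?thesis using ck(3) by (simp add: K_def n_def \<xi> C_fps_def)
  qed
  have second: "K (2 * \<xi> - 3) = monom (real (3 * \<xi> - 1) * Cat (\<xi> - 1)) (4 * \<xi> - 3)" if "\<xi> \<ge> 2"
  proof -
    have m: "m \<ge> 1" using that \<xi> by simp
    \<comment> \<open>The coefficient of \<open>Y\<close> belongs to \<open>s = n - 1\<close>, which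
      is positive here, so \<open>R\<close> does not enter.\<close>
    then have "c 1 = real (3 * m + 2) * Cat m" using ck(4) by (simp add: n_def slope_fps_nth)
    moreover have "2 * \<xi> - 3 = n - 1" "n - (n - 1) = 1" "n - 1 \<noteq> 0" "2 * \<xi> + (n - 1) = 4 * \<xi> - 3"
      "3 * \<xi> - 1 = 3 * m + 2"
      using m by (auto simp: n_def \<xi>)
    ultimately show ?thesis by (simp add: K_def \<xi>)
  qed
  define q where "q = ?Y / ?x * (?x\<^sup>2 / ?Y\<^sup>2) ^ \<xi>"
  have x: "?x \<noteq> 0" "?x \<noteq> 1" by (rule x_fls_neq)+
  have q: "q * ?Y ^ j = ?x ^ (2 * \<xi> + (n - j)) / (1 - ?x) ^ (n - j + 1)" if "j \<le> n" for j
    using expansion_term[OF x Y_fls_def, of j m] that by (simp only: q_def n_def \<xi>)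
  have top: "q * (?Y ^ n * (1 + ?Y) ^ i) = ?x ^ (2 * \<xi> - i) / (1 - ?x)" if "i \<in> {1..n}" for i
  proof -
    have Y: "1 + ?Y = 1 / ?x" using x by (simp add: Y_fls_def field_simps)
    have "i + (2 * \<xi> - i) = 2 * \<xi>" using that by (auto simp: n_def \<xi>)
    then have p: "?x ^ (2 * \<xi>) = ?x ^ i * ?x ^ (2 * \<xi> - i)" by (simp only: power_add[symmetric])
    have "q * (?Y ^ n * (1 + ?Y) ^ i) = ?x ^ (2 * \<xi>) / (1 - ?x) * (1 / ?x) ^ i"
      using q[of n] unfolding Y by (simp flip: mult.assoc)
    then show ?thesis using x unfolding p by (simp add: power_divide)
  qed
  have "fps_to_fls (\<Sum>s \<le> n. poly_at_fps (K s) (fps_X * C_fps ^ 2) * inverse ((1 - fps_X * C_fps ^ 2) ^ (s + 1))) =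
     (\<Sum>s\<le>n. fls_eval ?x (K s) / (1 - ?x) ^ (s + 1))"
    unfolding fps_to_fls_sum
  proof (rule sum.cong[OF refl])
    fix s
    have "((1 - fps_X * C_fps\<^sup>2) ^ (s + 1)) $ 0 \<noteq> 0" by (simp add: fps_nth_power_0)
    then have "fps_to_fls (inverse ((1 - fps_X * C_fps\<^sup>2) ^ (s + 1))) = inverse (fps_to_fls ((1 - fps_X * C_fps\<^sup>2) ^ (s + 1)))"
      by (rule fps_to_fls_inverse)
    also have "fps_to_fls ((1 - fps_X * C_fps\<^sup>2) ^ (s + 1)) = (1 - ?x) ^ (s + 1)"
      by (simp only: fps_to_fls_power fps_to_fls_minus fps_one_to_fls x_fls_def)
    finally show "fps_to_fls (poly_at_fps (K s) (fps_X * C_fps\<^sup>2) * inverse ((1 - fps_X * C_fps\<^sup>2) ^ (s + 1))) =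
        fls_eval ?x (K s) / (1 - ?x) ^ (s + 1)"
      by (simp only: fps_to_fls_mult[of "poly_at_fps _ _"] fps_to_fls_poly_at_fps x_fls_def divide_inverse)
  qed
  also have "\<dots> = (\<Sum>s\<le>n. fls_const (c (n - s)) * (?x ^ (2 * \<xi> + s) / (1 - ?x) ^ (s + 1))) +
      (\<Sum>s\<le>n. if s = 0 then fls_eval ?x R / (1 - ?x) else 0)"
    unfolding sum.distrib[symmetric]
    by (intro sum.cong refl) (simp add: K_def fls_eval_add fls_eval_monom add_divide_distrib)
  also have "(\<Sum>s\<le>n. if s = 0 then fls_eval ?x R / (1 - ?x) else 0) = fls_eval ?x R / (1 - ?x)" by simp
  also have "\<dots> = (\<Sum>i=1..n. fls_const (k i) * (?x ^ (2 * \<xi> - i) / (1 - ?x)))"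
    by (simp add: R_def fls_eval_sum fls_eval_monom sum_divide_distrib)
  also have "\<dots> = (\<Sum>i=1..n. fls_const (k i) * (q * (?Y ^ n * (1 + ?Y) ^ i)))"
    by (intro sum.cong refl) (simp only: top)
  also have "(\<Sum>s\<le>n. fls_const (c (n - s)) * (?x ^ (2 * \<xi> + s) / (1 - ?x) ^ (s + 1))) =
      (\<Sum>j\<le>n. fls_const (c j) * (q * ?Y ^ j))"
    unfolding sum_atMost_reverse[of "\<lambda>j. fls_const (c j) * (q * ?Y ^ j)"]
    by (intro sum.cong refl) (simp only: q diff_le_self diff_diff_cancel atMost_iff)
  also have "(\<Sum>j\<le>n. fls_const (c j) * (q * ?Y ^ j)) + (\<Sum>i=1..n. fls_const (k i) * (q * (?Y ^ n * (1 + ?Y) ^ i))) = q * f"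
    by (simp add: f_eq distrib_left sum_distrib_left mult_ac)
  finally have "fps_to_fls (W_fps \<xi>) = fps_to_fls (C_fps * (\<Sum>s \<le> n. poly_at_fps (K s) (fps_X * C_fps ^ 2) *
      inverse ((1 - fps_X * C_fps ^ 2) ^ (s + 1))))"
    unfolding f(2) q_def[symmetric] fps_to_fls_mult[of C_fps] by (simp only:)
  then have "W_fps \<xi> = C_fps * (\<Sum>s \<le> 2 * \<xi> - 2. poly_at_fps (K s) (fps_X * C_fps ^ 2) *
      inverse ((1 - fps_X * C_fps ^ 2) ^ (s + 1)))"
    by (simp only: fps_to_fls_eq_iff) (simp add: n_def \<xi>)
  then show ?thesis using nonneg degree lead second by blast
qed

theorem theorem1:
  shows "W_fps 0 = C_fps \<and>
    (\<forall>\<xi>::nat. \<xi> \<ge> 1 \<longrightarrow>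
      (\<exists>K :: nat \<Rightarrow> real poly.
         (\<forall>s \<le> 2 * \<xi> - 2. (\<forall>i. coeff (K s) i \<ge> 0) \<and> degree (K s) = 2 * \<xi> + s) \<and>
         W_fps \<xi> = C_fps * (\<Sum>s \<le> 2 * \<xi> - 2.
             poly_at_fps (K s) (fps_X * C_fps ^ 2)
             * inverse ((1 - fps_X * C_fps ^ 2) ^ (s + 1))) \<and>
         K (2 * \<xi> - 2) = monom (Cat (\<xi> - 1)) (4 * \<xi> - 2) \<and>
         (\<xi> \<ge> 2 \<longrightarrow> K (2 * \<xi> - 3) = monom (real (3 * \<xi> - 1) * Cat (\<xi> - 1)) (4 * \<xi> - 3))))"
  using W_fps_0 W_fps_kernels by blast

end
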